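(* Let $g\not\equiv 0$ be a concave non-decreasing function on $[0,1]$ such that $g(0)=0$ and $\int_0^1\frac{g(s)}{s}\,ds<\infty$. Then for every integer $N\ge 1$ and for every family of points $\{a_k\}_{0\le k<N}$ on the unit circle $\mathbb T$ we have $$\bigg\|\sum_{0\le k<N}\frac1{z-a_k}\bigg\|_{(g)}\ge \bigg\|\sum_{0\le k<N}\frac1{z-e^{2\pi ik/N}}\bigg\|_{(g)}=\|\Psi_N\|_{(g)}.$$ Furthermore, if $\{a_k\}_{0\le k<N}$ are points on the unit circle such that $$\bigg\|\sum_{0\le k<N}\frac1{z-a_k}\bigg\|_{(g)}=\|\Psi_N\|_{(g)},$$ then the points $\{a_k\}_{0\le k<N}$ are equispaced on the unit circle.
   Context: $\mathbb D$ is the open unit disk of $\mathbb C$, $\mathbb T$ is the unit circle, and $m_2$ is normalized planar Lebesgue measure, $dm_2(z)=\pi^{-1}\,dx\,dy$, $z=x+iy$. For an integrable positive function $g$ on $[0,1]$ (here the value at the endpoint $0$ may be zero) and $f$ holomorphic in $\mathbb D$, $$\|f\|_{(g)}^2=\kappa_g\int_{\mathbb D}|f(z)|^2\,g(1-|z|^2)\,dm_2(z),\qquad \kappa_g=\Bigl(\int_0^1 g(t)\,dt\Bigr)^{-1}.$$ For $N\ge1$, $\Psi_N(z)=\sum_{0\le k<N}\frac1{z-e^{2\pi ik/N}}$. Points of a family need not be distinct. The family $\{a_k\}_{0\le k<N}\subset\mathbb T$ is equispaced if, up to reordering, $a_k=\lambda e^{2\pi i k/N}$, $0\le k<N$, for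 some $\lambda\in\mathbb T$. *)

theory Defs
  imports "HOL-Analysis.Analysis" "HOL-Combinatorics.Permutations"
begin

definition unit_disc :: "complex set" (\<open>\<bbbD>\<close>)
  where "\<bbbD> = ball 0 1"

definition unit_circle :: "complex set" (\<open>\<bbbT>\<close>)
  where "\<bbbT> = sphere 0 1"

definition m\<^sub>2 :: "complex measure"
  where "m\<^sub>2 = scale_measure (ennreal (1 / pi)) lborel"

definition kappa :: "(real \<Rightarrow> real) \<Rightarrow> real"
  where "kappa g = inverse (LBINT t:{0..1}. g t)"

(* For weights g that are nonnegative on [0,1]: ennreal would truncate negative values. *)
definition wnorm_sq :: "(real \<Rightarrow> real) \<Rightarrow> (complex \<Rightarrow> complex) \<Rightarrow> ennreal"
  where "wnorm_sq g f =
    ennreal (kappa g) * (\<integral>\<^sup>+z\<in>\<bbbD>. ennreal ((cmod (f z))\<^sup>2 * g (1 - (cmod z)\<^sup>2)) \<partial>m\<^sub>2)"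

(* The norm is extended-valued, so that a function outside the weighted space has
   infinite norm rather than a conventional value 0. *)
definition wnorm :: "(real \<Rightarrow> real) \<Rightarrow> (complex \<Rightarrow> complex) \<Rightarrow> ennreal"
  where "wnorm g f =
    (if wnorm_sq g f = \<infinity> then \<infinity> else ennreal (sqrt (enn2real (wnorm_sq g f))))"

definition root_of_unity :: "nat \<Rightarrow> nat \<Rightarrow> complex"
  where "root_of_unity N k = exp (2 * of_real pi * \<i> * of_nat k / of_nat N)"

definition Psi :: "nat \<Rightarrow> complex \<Rightarrow> complex"
  where "Psi N z = (\<Sum>k<N. 1 / (z - root_of_unity N k))"

(* A family of N points is the restriction of a :: nat \<Rightarrow> complex to {..<N};
   repetitions are allowed in general. *)
definition equispaced :: "nat \<Rightarrow> (nat \<Rightarrow> complex) \<Rightarrow> bool"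
  where "equispaced N a \<longleftrightarrow>
    (\<exists>c\<in>\<bbbT>. \<exists>p. p permutes {..<N} \<and> (\<forall>k<N. a (p k) = c * root_of_unity N k))"

end

theory Submission
  imports Defs "HOL-Real_Asymp.Real_Asymp"
begin

text \<open>Averaging the integrand over rotations turns the squared norm into an energy: for
  \<open>a\<^sub>k = cis \<theta>\<^sub>k\<close> it equals \<open>\<kappa>\<^sub>g \<Sum>\<^sub>j \<Sum>\<^sub>k K (\<theta>\<^sub>k - \<theta>\<^sub>j)\<close>, where
  \<open>K \<theta> = \<integral> g t * Re (u / (1 - (1 - t) u)) dt\<close> over \<open>[0, 1]\<close> with \<open>u = cis \<theta>\<close>.
  For \<open>g t = min t c\<close> the potential \<open>K\<close> is explicit and its second derivative on \<open>(0, 2\<pi>)\<close> is at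
  least \<open>c / 8\<close>. A concave non-decreasing \<open>g\<close> with \<open>g 0 = 0\<close> is a limit of nonnegative combinations of
  such weights, so \<open>K - g 1 / 16 * \<theta>\<^sup>2\<close> is convex on \<open>[0, 2\<pi>]\<close>. Jensen's inequality, applied for each
  \<open>l\<close> to the arcs that join every point to the one \<open>l\<close> steps further, then shows that equispaced points
  minimise the energy, and the quadratic term makes them the only minimisers.\<close>

section \<open>Integration over the disc\<close>

lemma nn_integral_lborel_diff:
  fixes w :: "'a::euclidean_space"
  assumes [measurable]: "f \<in> borel_measurable borel"
  shows "(\<integral>\<^sup>+x. f (w - x) \<partial>lborel) = (\<integral>\<^sup>+x. f x \<partial>lborel)"
proof -
  have "lborel = density (distr lborel borel (\<lambda>x. w + (-1) *\<^sub>R x)) (\<lambda>_. ennreal (\<bar>-1\<bar>^DIM('a)))"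
    by (rule lborel_affine) auto
  then have "lborel = distr lborel borel (\<lambda>x. w - x)"
    by (simp add: density_1)
  then have "(\<integral>\<^sup>+x. f x \<partial>lborel) = (\<integral>\<^sup>+x. f x \<partial>distr lborel borel (\<lambda>x. w - x))"
    by metis
  also have "\<dots> = (\<integral>\<^sup>+x. f (w - x) \<partial>lborel)"
    by (subst nn_integral_distr) auto
  finally show ?thesis by simp
qed

lemma nn_integral_lborel_shift:
  fixes w :: "'a::euclidean_space"
  assumes [measurable]: "f \<in> borel_measurable borel"
  shows "(\<integral>\<^sup>+x. f (x - w) \<partial>lborel) = (\<integral>\<^sup>+x. f x \<partial>lborel)"
proof -
  have "(\<integral>\<^sup>+x. f x \<partial>lborel) = (\<integral>\<^sup>+x. f x \<partial>distr lborel borel ((+) (-w)))"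
    by (simp only: lborel_distr_plus)
  also have "\<dots> = (\<integral>\<^sup>+x. f (x - w) \<partial>lborel)"
    by (subst nn_integral_distr) auto
  finally show ?thesis by simp
qed

text \<open>Uniqueness of Haar measure by Fubini: the convolution of the indicators of \<open>A\<close> and of the
  unit ball is integrated in two ways.\<close>

lemma lborel_distr_orthogonal_transformation:
  fixes T :: "'a::euclidean_space \<Rightarrow> 'a"
  assumes T: "orthogonal_transformation T"
  shows "distr lborel borel T = lborel"
proof (rule measure_eqI)
  have lin: "linear T" and norm_T: "norm (T x) = norm x" for x
    using T by (auto simp: orthogonal_transformation)
  have surj: "surj T"
    using T by (rule orthogonal_transformation_surj)
  have [measurable]: "T \<in> borel_measurable borel"
    using lin by (intro borel_measurable_continuous_onI linear_continuous_on linear_conv_bounded_linear[THEN iffD1])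
  show "sets (distr lborel borel T) = sets lborel" by simp
  fix A assume "A \<in> sets (distr lborel borel T)"
  then have [measurable]: "A \<in> sets borel" by simp
  \<comment> \<open>The unit ball is invariant under \<open>T\<close>, and its measure is positive
    and finite, so it can be cancelled at the end.\<close>
  define B :: "'a set" where "B = ball 0 1"
  have [measurable]: "B \<in> sets borel" by (simp add: B_def)
  have TB: "indicator B (T x) = (indicator B x :: ennreal)" for x
    by (simp add: B_def norm_T indicator_def)
  have Tdiff: "T (w - x) = T w - T x" for w x
    by (rule linear_diff[OF lin])
  have "emeasure (distr lborel borel T) A * emeasure lborel B
      = (\<integral>\<^sup>+x. indicator A (T x) * emeasure lborel B \<partial>lborel)"
    by (subst nn_integral_multc) (auto simp: emeasure_distr nn_integral_distr
      simp flip: nn_integral_indicator)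
  also have "\<dots> = (\<integral>\<^sup>+x. \<integral>\<^sup>+y. indicator A (T x) * indicator B (y - T x) \<partial>lborel \<partial>lborel)"
  proof (rule nn_integral_cong)
    fix x
    have "(\<integral>\<^sup>+y. indicator B (y - T x) \<partial>lborel) = emeasure lborel B"
      by (subst nn_integral_lborel_shift) auto
    then show "indicator A (T x) * emeasure lborel B
        = (\<integral>\<^sup>+y. indicator A (T x) * indicator B (y - T x) \<partial>lborel)"
      by (simp add: nn_integral_cmult)
  qed
  also have "\<dots> = (\<integral>\<^sup>+y. \<integral>\<^sup>+x. indicator A (T x) * indicator B (y - T x) \<partial>lborel \<partial>lborel)"
    by (rule lborel_pair.Fubini') simp
  also have "\<dots> = (\<integral>\<^sup>+y. \<integral>\<^sup>+x. indicator A (y - T x) * indicator B x \<partial>lborel \<partial>lborel)"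
  proof (rule nn_integral_cong)
    fix y
    \<comment> \<open>With \<open>y = T w\<close> the substitution \<open>x \<mapsto> w - x\<close>
      exchanges the arguments of the two indicators: \<open>T x\<close> and \<open>y - T x\<close>
      trade places, and invariance of \<open>B\<close> removes \<open>T\<close> from the second
      factor.\<close>
    obtain w where w: "y = T w" using surj by (metis surjD)
    show "(\<integral>\<^sup>+x. indicator A (T x) * indicator B (y - T x) \<partial>lborel)
        = (\<integral>\<^sup>+x. indicator A (y - T x) * indicator B x \<partial>lborel :: ennreal)"
      by (subst nn_integral_lborel_diff[symmetric, of _ w]) (auto simp: w Tdiff TB)
  qed
  also have "\<dots> = (\<integral>\<^sup>+x. \<integral>\<^sup>+y. indicator A (y - T x) * indicator B x \<partial>lborel \<partial>lborel)"
    by (rule lborel_pair.Fubini'[symmetric]) simp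
  also have "\<dots> = (\<integral>\<^sup>+x. emeasure lborel A * indicator B x \<partial>lborel)"
  proof (rule nn_integral_cong)
    fix x
    have "(\<integral>\<^sup>+y. indicator A (y - T x) \<partial>lborel) = emeasure lborel A"
      by (subst nn_integral_lborel_shift) auto
    then show "(\<integral>\<^sup>+y. indicator A (y - T x) * indicator B x \<partial>lborel)
        = emeasure lborel A * indicator B x"
      by (simp add: nn_integral_multc)
  qed
  also have "\<dots> = emeasure lborel A * emeasure lborel B"
    by (simp add: nn_integral_cmult)
  finally have "emeasure (distr lborel borel T) A * emeasure lborel B
      = emeasure lborel A * emeasure lborel B" .
  moreover have "emeasure lborel B \<noteq> 0" "emeasure lborel B \<noteq> top"
    by (auto simp: B_def emeasure_ball ennreal_eq_0_iff unit_ball_vol_pos not_le)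
  ultimately show "emeasure (distr lborel borel T) A = emeasure lborel A"
    by (metis ennreal_mult_cancel_left mult.commute)
qed

lemma nn_integral_rotate:
  assumes u: "cmod u = 1" and [measurable]: "f \<in> borel_measurable borel"
  shows "(\<integral>\<^sup>+z. f (u * z) \<partial>lborel) = (\<integral>\<^sup>+z. f z \<partial>lborel)"
proof -
  have "orthogonal_transformation ((*) u)"
    unfolding orthogonal_transformation using u
    by (auto simp: norm_mult bounded_linear_mult_right bounded_linear.linear)
  then have "(\<integral>\<^sup>+z. f z \<partial>lborel) = (\<integral>\<^sup>+z. f z \<partial>distr lborel borel ((*) u))"
    by (simp add: lborel_distr_orthogonal_transformation)
  also have "\<dots> = (\<integral>\<^sup>+z. f (u * z) \<partial>lborel)"
    by (subst nn_integral_distr) auto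
  finally show ?thesis by simp
qed

section \<open>Radial integrals over the disc\<close>

lemma emeasure_density_indicator:
  assumes "A \<in> sets M" "B \<in> sets M"
  shows "emeasure (density M (indicator A)) B = emeasure M (A \<inter> B)"
  using assms by (subst emeasure_density) (auto simp flip: indicator_inter_arith)

text \<open>A disc of radius r has normalized area r^2, so 1 - |z|^2 is uniformly distributed on
  [0, 1]. For finite measures on the line it is enough to compare the half-lines
  \<open>{x<..}\<close>.\<close>

lemma distr_unit_disc:
  "distr (density m\<^sub>2 (indicator \<bbbD>)) borel (\<lambda>z. 1 - (cmod z)\<^sup>2)
    = density lborel (indicator {0..1})"
proof (rule measure_eqI_lessThan)
  have [measurable]: "\<bbbD> \<in> sets borel" by (simp add: unit_disc_def)
  have [measurable_cong]: "sets m\<^sub>2 = sets borel" by (simp add: m\<^sub>2_def)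
  have sp: "space m\<^sub>2 = UNIV" by (simp add: m\<^sub>2_def space_scale_measure)
  fix x :: real
  have R: "emeasure (density lborel (indicator {0..1})) {x<..}
      = emeasure lborel ({0..1} \<inter> {x<..})"
    by (simp add: emeasure_density_indicator)
  have Re: "emeasure lborel ({0..1} \<inter> {x<..}) = ennreal (min 1 (max 0 (1 - x)))"
  proof -
    have "{0..1} \<inter> {x<..} = (if x < 0 then {0..1} else {x<..1})" by auto
    then show ?thesis by (auto simp: min_def max_def)
  qed
  have "emeasure (distr (density m\<^sub>2 (indicator \<bbbD>)) borel (\<lambda>z. 1 - (cmod z)\<^sup>2)) {x<..}
      = emeasure m\<^sub>2 (\<bbbD> \<inter> ((\<lambda>z. 1 - (cmod z)\<^sup>2) -` {x<..}))"
    by (subst emeasure_distr; simp add: emeasure_density_indicator sp vimage_def)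
  \<comment> \<open>The clamping covers \<open>x < 0\<close>, where the whole disc remains, and
    \<open>x \<ge> 1\<close>, where the ball has radius 0 and is empty.\<close>
  also have "\<bbbD> \<inter> ((\<lambda>z. 1 - (cmod z)\<^sup>2) -` {x<..}) = ball 0 (sqrt (min 1 (max 0 (1 - x))))"
  proof (intro set_eqI)
    fix z :: complex
    have "cmod z < 1 \<longleftrightarrow> (cmod z)\<^sup>2 < 1"
      by (simp add: abs_square_less_1)
    moreover have "cmod z < sqrt y \<longleftrightarrow> (cmod z)\<^sup>2 < y" if "y \<ge> 0" for y
      using that by (metis norm_ge_zero real_less_rsqrt real_sqrt_less_iff real_sqrt_unique)
    from this[of "min 1 (max 0 (1 - x))"]
    have "cmod z < sqrt (min 1 (max 0 (1 - x))) \<longleftrightarrow> (cmod z)\<^sup>2 < min 1 (max 0 (1 - x))"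
      by simp
    ultimately show "z \<in> \<bbbD> \<inter> ((\<lambda>z. 1 - (cmod z)\<^sup>2) -` {x<..})
        \<longleftrightarrow> z \<in> ball 0 (sqrt (min 1 (max 0 (1 - x))))"
      by (simp add: unit_disc_def) (use zero_le_power2[of "cmod z"] in linarith)
  qed
  also have "emeasure m\<^sub>2 \<dots> = ennreal (min 1 (max 0 (1 - x)))"
    by (simp add: m\<^sub>2_def emeasure_scale_measure emeasure_ball unit_ball_vol_2 ennreal_mult''[symmetric]
      flip: ennreal_mult)
  finally have L: "emeasure (distr (density m\<^sub>2 (indicator \<bbbD>)) borel (\<lambda>z. 1 - (cmod z)\<^sup>2)) {x<..}
      = ennreal (min 1 (max 0 (1 - x)))" .
  show "emeasure (distr (density m\<^sub>2 (indicator \<bbbD>)) borel (\<lambda>z. 1 - (cmod z)\<^sup>2)) {x<..}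
      = emeasure (density lborel (indicator {0..1})) {x<..}"
    by (simp only: L R Re)
  show "emeasure (distr (density m\<^sub>2 (indicator \<bbbD>)) borel (\<lambda>z. 1 - (cmod z)\<^sup>2)) {x<..} < \<infinity>"
    by (simp add: L)
qed simp_all

lemma nn_integral_unit_disc_radial:
  assumes [measurable]: "\<phi> \<in> borel_measurable borel"
  shows "(\<integral>\<^sup>+z\<in>\<bbbD>. \<phi> (1 - (cmod z)\<^sup>2) \<partial>m\<^sub>2) = (\<integral>\<^sup>+t\<in>{0..1}. \<phi> t \<partial>lborel)"
proof -
  have [measurable]: "\<bbbD> \<in> sets borel" by (simp add: unit_disc_def)
  have [measurable_cong]: "sets m\<^sub>2 = sets borel" by (simp add: m\<^sub>2_def)
  have "(\<integral>\<^sup>+t\<in>{0..1}. \<phi> t \<partial>lborel) = (\<integral>\<^sup>+t. \<phi> t \<partial>density lborel (indicator {0..1}))"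
    by (subst nn_integral_density) (auto simp: mult.commute)
  also have "\<dots> = (\<integral>\<^sup>+z. \<phi> (1 - (cmod z)\<^sup>2) \<partial>density m\<^sub>2 (indicator \<bbbD>))"
    unfolding distr_unit_disc[symmetric] by (subst nn_integral_distr) auto
  also have "\<dots> = (\<integral>\<^sup>+z\<in>\<bbbD>. \<phi> (1 - (cmod z)\<^sup>2) \<partial>m\<^sub>2)"
    by (subst nn_integral_density) (auto simp: mult.commute)
  finally show ?thesis by simp
qed

section \<open>Mean values on circles\<close>

text \<open>The mean value property, by an explicit antiderivative
  \<open>\<alpha> + \<i> * Ln (1 - cis \<alpha> * w)\<close>. The argument of the logarithm has
  positive real part because \<open>cmod w < 1\<close>; the logarithm returns to its initial value
  after a full turn, so only the linear term contributes.\<close>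

lemma has_integral_circle_mean:
  assumes w: "cmod w < 1"
  shows "((\<lambda>\<alpha>. 1 / (1 - cis \<alpha> * w)) has_integral (2 * pi)) {0..2*pi}"
proof -
  have "((\<lambda>\<alpha>. complex_of_real \<alpha> + \<i> * Ln (1 - exp (\<i> * of_real \<alpha>) * w)) has_vector_derivative
        1 / (1 - cis \<alpha> * w)) (at \<alpha> within {0..2*pi})" for \<alpha> :: real
  proof (rule has_vector_derivative_real_field)
    have "Re (exp (\<i> * of_real \<alpha>) * w) \<le> cmod (exp (\<i> * of_real \<alpha>) * w)"
      by (rule complex_Re_le_cmod)
    also have "\<dots> < 1" using w by (simp add: norm_mult)
    finally have *: "Re (exp (\<i> * of_real \<alpha>) * w) < 1" .
    then have "1 - exp (\<i> * of_real \<alpha>) * w \<noteq> 0"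
      by (metis less_irrefl one_complex.sel(1) right_minus_eq)
    with * show "((\<lambda>\<alpha>. \<alpha> + \<i> * Ln (1 - exp (\<i> * \<alpha>) * w)) has_field_derivative
        1 / (1 - cis \<alpha> * w)) (at (complex_of_real \<alpha>))"
      by (auto intro!: derivative_eq_intros simp: complex_nonpos_Reals_iff cis_conv_exp field_simps)
  qed
  from fundamental_theorem_of_calculus[OF _ this]
  show ?thesis
    by (simp add: algebra_simps exp_eq_1)
qed

text \<open>Applied with \<open>x\<close> and \<open>y\<close> rotating in opposite directions, so that \<open>x * y\<close> is constant along
  the circle.\<close>

lemma mult_cauchy_kernels:
  fixes x y :: "'a::field"
  assumes "x \<noteq> 1" "y \<noteq> 1" "x * y \<noteq> 1"
  shows "1 / ((1 - x) * (1 - y)) = (1 / (1 - x) + 1 / (1 - y) - 1) / (1 - x * y)"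
  using assms by (simp add: divide_simps) (simp add: algebra_simps)

text \<open>The squared modulus expands into a double sum of products of Cauchy kernels. Each
  product splits by \<open>mult_cauchy_kernels\<close> into kernels of known mean, times a factor
  \<open>W j k\<close> that is constant along the circle.\<close>

lemma has_integral_simple_fraction_circle:
  fixes N :: nat
  assumes a: "\<And>k. k < N \<Longrightarrow> cmod (a k) = 1" and z: "cmod z < 1"
  shows "((\<lambda>\<alpha>. (cmod (\<Sum>k<N. 1 / (cis \<alpha> * z - a k)))\<^sup>2) has_integral
    2 * pi * (\<Sum>j<N. \<Sum>k<N. Re (cnj (a j) * a k / (1 - (cmod z)\<^sup>2 * (cnj (a j) * a k))))) {0..2*pi}"
proof -
  define W where "W j k = cnj (a j) * a k / (1 - (cmod z)\<^sup>2 * (cnj (a j) * a k))" for j k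
  define M where "M j \<alpha> = 1 / (1 - cis \<alpha> * (z * cnj (a j)))" for j \<alpha>
  have M: "(M j has_integral (2 * pi)) {0..2*pi}" if "j < N" for j
    unfolding M_def using that a z by (intro has_integral_circle_mean) (simp add: norm_mult)
  have cM: "((\<lambda>\<alpha>. cnj (M j \<alpha>)) has_integral (2 * pi)) {0..2*pi}" if "j < N" for j
    using has_integral_cnj[of "M j" "2*pi" "{0..2*pi}"] M[OF that] by (simp add: o_def)
  have eq: "complex_of_real ((cmod (\<Sum>k<N. 1 / (cis \<alpha> * z - a k)))\<^sup>2)
      = (\<Sum>j<N. \<Sum>k<N. W j k * (M j \<alpha> + cnj (M k \<alpha>) - 1))" for \<alpha>
  proof -
    have tm: "1 / (cis \<alpha> * z - a j) * cnj (1 / (cis \<alpha> * z - a k)) = W j k * (M j \<alpha> + cnj (M k \<alpha>) - 1)"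
      if "j < N" "k < N" for j k
    proof -
      define x where "x = cis \<alpha> * (z * cnj (a j))"
      define y where "y = cnj (cis \<alpha> * (z * cnj (a k)))"
      have nx: "cmod x < 1" and ny: "cmod y < 1"
        using that a z by (auto simp: x_def y_def norm_mult)
      have nxy: "cmod (x * y) < 1"
        using nx ny by (metis mult_strict_mono' norm_ge_zero norm_mult mult_1)
      have xy: "x * y = (cmod z)\<^sup>2 * (cnj (a j) * a k)"
      proof -
        have "x * y = (cis \<alpha> * cnj (cis \<alpha>)) * (z * cnj z) * (cnj (a j) * a k)"
          by (simp add: x_def y_def mult_ac)
        also have "cis \<alpha> * cnj (cis \<alpha>) = 1" by (simp add: cis_cnj cis_mult)
        also have "z * cnj z = (cmod z)\<^sup>2" by (simp only: complex_norm_square)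
        finally show ?thesis by simp
      qed
      have aj: "a j * cnj (a j) = 1" "a k * cnj (a k) = 1"
        using a that by (simp_all flip: complex_norm_square)
      have "cis \<alpha> * z - a j = - (a j * (1 - x))"
        using aj by (simp add: x_def algebra_simps)
      moreover have "1 / a j = cnj (a j)"
        using aj by (simp add: divide_eq_eq) (metis aj(1) mult.commute mult_zero_left zero_neq_one)
      ultimately have 1: "1 / (cis \<alpha> * z - a j) = - (cnj (a j) / (1 - x))"
        by (metis divide_minus_right divide_divide_eq_left)
      have "cnj (cis \<alpha> * z - a k) = - (cnj (a k) * (1 - y))"
        using aj by (simp add: y_def algebra_simps)
      moreover have "1 / cnj (a k) = a k"
        using aj by (simp add: divide_eq_eq)
      ultimately have 2: "cnj (1 / (cis \<alpha> * z - a k)) = - (a k / (1 - y))"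
        by (metis divide_minus_right divide_divide_eq_left complex_cnj_divide complex_cnj_one)
      have "1 / (cis \<alpha> * z - a j) * cnj (1 / (cis \<alpha> * z - a k)) = cnj (a j) * a k * (1 / ((1 - x) * (1 - y)))"
        unfolding 1 2 by simp
      also have "1 / ((1 - x) * (1 - y)) = (1 / (1 - x) + 1 / (1 - y) - 1) / (1 - x * y)"
        using nx ny nxy by (intro mult_cauchy_kernels) auto
      also have "1 / (1 - x) = M j \<alpha>" by (simp add: M_def x_def)
      also have "1 / (1 - y) = cnj (M k \<alpha>)" by (simp add: M_def y_def)
      finally show ?thesis by (simp add: W_def xy)
    qed
    show ?thesis
      unfolding complex_norm_square cnj_sum sum_product
      by (intro sum.cong refl tm) auto
  qed
  have one: "((\<lambda>_. 1::complex) has_integral (2 * pi)) {0..2*pi}"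
    using has_integral_const_real[of "1::complex" 0 "2*pi"] by (simp add: scaleR_conv_of_real)
  \<comment> \<open>Each of the three terms has mean 1, so the combination has mean 1 + 1 - 1 = 1
    and only \<open>W j k\<close> survives.\<close>
  have "((\<lambda>\<alpha>. M j \<alpha> + cnj (M k \<alpha>) - 1) has_integral (2 * pi)) {0..2*pi}"
    if "j < N" "k < N" for j k
    using has_integral_diff[OF has_integral_add[OF M[OF that(1)] cM[OF that(2)]] one] by simp
  then have int: "((\<lambda>\<alpha>. complex_of_real ((cmod (\<Sum>k<N. 1 / (cis \<alpha> * z - a k)))\<^sup>2)) has_integral
      (\<Sum>j<N. \<Sum>k<N. W j k * (2 * pi))) {0..2*pi}"
    unfolding eq by (intro has_integral_sum has_integral_mult_right finite_lessThan) auto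
  have "Re (W j k * complex_of_real (2 * pi)) = 2 * pi * Re (W j k)" for j k
    by simp
  with has_integral_Re[OF int] show ?thesis
    by (simp only: W_def Re_sum sum_distrib_left Re_complex_of_real)
qed

lemma nn_integral_disc_rotate:
  assumes u: "cmod u = 1" and [measurable]: "f \<in> borel_measurable borel"
  shows "(\<integral>\<^sup>+z\<in>\<bbbD>. f (u * z) \<partial>m\<^sub>2) = (\<integral>\<^sup>+z\<in>\<bbbD>. f z \<partial>m\<^sub>2)"
proof -
  have [measurable]: "\<bbbD> \<in> sets borel" by (simp add: unit_disc_def)
  have "indicator \<bbbD> (u * z) = (indicator \<bbbD> z :: ennreal)" for z
    using u by (simp add: unit_disc_def indicator_def norm_mult)
  then show ?thesis
    using nn_integral_rotate[OF u, of "\<lambda>z. f z * indicator \<bbbD> z"]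
    by (simp add: m\<^sub>2_def nn_integral_scale_measure)
qed

text \<open>The disc integral does not change under rotation, so it equals its average over all
  angles. Fubini moves the average inside, where the circle means are known, and a radial integrand
  is left.\<close>

lemma nn_integral_disc_simple_fraction:
  fixes N :: nat
  assumes a: "\<And>k. k < N \<Longrightarrow> cmod (a k) = 1"
    and [measurable]: "G \<in> borel_measurable borel" and G: "\<And>t. G t \<ge> 0"
  defines "S \<equiv> \<lambda>t. (\<Sum>j<N. \<Sum>k<N. Re (cnj (a j) * a k / (1 - complex_of_real (1 - t) * (cnj (a j) * a k))))"
  shows "(\<integral>\<^sup>+z\<in>\<bbbD>. ennreal ((cmod (\<Sum>k<N. 1 / (z - a k)))\<^sup>2 * G (1 - (cmod z)\<^sup>2)) \<partial>m\<^sub>2)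
      = (\<integral>\<^sup>+t\<in>{0..1}. ennreal (G t * S t) \<partial>lborel)"
    and "\<And>t. 0 < t \<Longrightarrow> t \<le> 1 \<Longrightarrow> S t \<ge> 0"
proof -
  define f where "f z = (\<Sum>k<N. 1 / (z - a k))" for z
  have [measurable]: "f \<in> borel_measurable borel"
    unfolding f_def by measurable
  have [measurable]: "cis \<in> borel_measurable borel"
    by (intro borel_measurable_continuous_onI continuous_intros)
  have [measurable]: "S \<in> borel_measurable borel"
    unfolding S_def by measurable
  have [measurable]: "\<bbbD> \<in> sets borel" by (simp add: unit_disc_def)
  have [measurable_cong]: "sets m\<^sub>2 = sets borel" by (simp add: m\<^sub>2_def)
  have sf: "sigma_finite_measure m\<^sub>2"
  proof -
    have "m\<^sub>2 = density lborel (\<lambda>_. ennreal (1/pi))"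
      by (rule measure_eqI)
         (auto simp: m\<^sub>2_def emeasure_scale_measure emeasure_density nn_integral_cmult)
    moreover have "sigma_finite_measure (density lborel (\<lambda>_. ennreal (1/pi)) :: complex measure)"
      by (subst sigma_finite_measure.sigma_finite_iff_density_finite[OF sigma_finite_lborel]) auto
    ultimately show ?thesis by simp
  qed
  interpret m2: sigma_finite_measure m\<^sub>2 by (rule sf)
  interpret pair_sigma_finite lborel m\<^sub>2 ..
  have int: "((\<lambda>\<alpha>. (cmod (f (cis \<alpha> * z)))\<^sup>2) has_integral 2 * pi * S (1 - (cmod z)\<^sup>2)) {0..2*pi}"
    if "cmod z < 1" for z
    using has_integral_simple_fraction_circle[of N a z, OF a that] by (simp add: f_def S_def)
  have nonneg: "S (1 - (cmod z)\<^sup>2) \<ge> 0" if "cmod z < 1" for z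
    using has_integral_nonneg[OF int[OF that]] pi_gt_zero by (auto simp add: zero_le_mult_iff)
  \<comment> \<open>\<open>S t\<close> is the mean of a squared modulus over the circle |z|^2 = 1 -
    t; \<open>0 < t\<close> keeps this circle inside the open disc.\<close>
  show "S t \<ge> 0" if "0 < t" "t \<le> 1" for t
    using nonneg[of "of_real (sqrt (1 - t))"] that by simp
  define I where "I = (\<integral>\<^sup>+z\<in>\<bbbD>. ennreal ((cmod (f z))\<^sup>2 * G (1 - (cmod z)\<^sup>2)) \<partial>m\<^sub>2)"
  have rot: "(\<integral>\<^sup>+z\<in>\<bbbD>. ennreal ((cmod (f (cis \<alpha> * z)))\<^sup>2 * G (1 - (cmod z)\<^sup>2)) \<partial>m\<^sub>2) = I" for \<alpha>
    unfolding I_def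
    using nn_integral_disc_rotate[of "cis \<alpha>" "\<lambda>z. ennreal ((cmod (f z))\<^sup>2 * G (1 - (cmod z)\<^sup>2))"]
    by (simp add: norm_mult)
  have "ennreal (2 * pi) * I = (\<integral>\<^sup>+\<alpha>. I * indicator {0..2*pi} \<alpha> \<partial>lborel)"
    by (simp add: nn_integral_cmult mult.commute)
  also have "\<dots> = (\<integral>\<^sup>+\<alpha>. \<integral>\<^sup>+z. ennreal ((cmod (f (cis \<alpha> * z)))\<^sup>2 * G (1 - (cmod z)\<^sup>2)) * indicator \<bbbD> z
      * indicator {0..2*pi} \<alpha> \<partial>m\<^sub>2 \<partial>lborel)"
    by (intro nn_integral_cong) (simp add: nn_integral_multc rot)
  also have "\<dots> = (\<integral>\<^sup>+z. \<integral>\<^sup>+\<alpha>. ennreal ((cmod (f (cis \<alpha> * z)))\<^sup>2 * G (1 - (cmod z)\<^sup>2)) * indicator \<bbbD> z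
      * indicator {0..2*pi} \<alpha> \<partial>lborel \<partial>m\<^sub>2)"
    by (rule Fubini'[symmetric]) measurable
  also have "\<dots> = (\<integral>\<^sup>+z\<in>\<bbbD>. ennreal (2 * pi) * ennreal (G (1 - (cmod z)\<^sup>2) * S (1 - (cmod z)\<^sup>2)) \<partial>m\<^sub>2)"
  proof (rule nn_integral_cong)
    fix z
    show "(\<integral>\<^sup>+\<alpha>. ennreal ((cmod (f (cis \<alpha> * z)))\<^sup>2 * G (1 - (cmod z)\<^sup>2)) * indicator \<bbbD> z
        * indicator {0..2*pi} \<alpha> \<partial>lborel)
      = ennreal (2 * pi) * ennreal (G (1 - (cmod z)\<^sup>2) * S (1 - (cmod z)\<^sup>2)) * indicator \<bbbD> z"
    proof (cases "z \<in> \<bbbD>")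
      case True
      then have z: "cmod z < 1" by (simp add: unit_disc_def)
      have "(\<integral>\<^sup>+\<alpha>. ennreal ((cmod (f (cis \<alpha> * z)))\<^sup>2 * G (1 - (cmod z)\<^sup>2)) * indicator {0..2*pi} \<alpha> \<partial>lborel)
        = ennreal (2 * pi * S (1 - (cmod z)\<^sup>2) * G (1 - (cmod z)\<^sup>2))"
        using int[OF z] G by (intro nn_integral_has_integral_lebesgue' has_integral_mult_left) auto
      then show ?thesis
        using True G nonneg[OF z] by (simp add: mult_ac flip: ennreal_mult)
    qed auto
  qed
  also have "\<dots> = ennreal (2 * pi) * (\<integral>\<^sup>+z\<in>\<bbbD>. ennreal (G (1 - (cmod z)\<^sup>2) * S (1 - (cmod z)\<^sup>2)) \<partial>m\<^sub>2)"
    by (subst nn_integral_cmult[symmetric]) (auto simp: mult.assoc)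
  also have "(\<integral>\<^sup>+z\<in>\<bbbD>. ennreal (G (1 - (cmod z)\<^sup>2) * S (1 - (cmod z)\<^sup>2)) \<partial>m\<^sub>2)
      = (\<integral>\<^sup>+t\<in>{0..1}. ennreal (G t * S t) \<partial>lborel)"
    by (rule nn_integral_unit_disc_radial) measurable
  finally show "(\<integral>\<^sup>+z\<in>\<bbbD>. ennreal ((cmod (\<Sum>k<N. 1 / (z - a k)))\<^sup>2 * G (1 - (cmod z)\<^sup>2)) \<partial>m\<^sub>2)
      = (\<integral>\<^sup>+t\<in>{0..1}. ennreal (G t * S t) \<partial>lborel)"
    by (simp add: ennreal_mult_cancel_left I_def f_def)
qed

section \<open>The potential of a truncated linear weight\<close>

text \<open>For \<open>0 < t \<le> 1\<close> and r = 1 - t this is the series of r^n cos ((n + 1)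
  \<open>\<theta>\<close>) over n. It is the real part of the mean of (1 / (z - a)) times the
  conjugate of (1 / (z - b)) over the circle |z|^2 = r, for unit a and b that differ by the angle
  \<open>\<theta>\<close>.\<close>

definition kern :: "real \<Rightarrow> real \<Rightarrow> real"
  where "kern t \<theta> = Re (cis \<theta> / (1 - of_real (1 - t) * cis \<theta>))"

definition potential :: "(real \<Rightarrow> real) \<Rightarrow> real \<Rightarrow> real"
  where "potential g \<theta> = (LBINT t:{0..1}. g t * kern t \<theta>)"

lemma Re_of_real_mult: "Re (of_real r * w) = r * Re w"
  by simp

text \<open>For r < 1 the map 1 / (1 - w) sends the circle |w| = r to the circle with diameter from
  1 / (1 + r) to 1 / (1 - r), so the real part is smallest at w = -r; for r = 1 the image is the
  line where it is 1/2. With x = Re w the bound reduces to (r + x)(1 - r) being nonnegative.\<close>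

lemma Re_inverse_one_minus_ge:
  assumes "cmod w \<le> 1" "w \<noteq> 1"
  shows "Re (1 / (1 - w)) \<ge> 1 / (1 + cmod w)"
proof -
  define r x where "r = cmod w" and "x = Re w"
  have r: "0 \<le> r" "r \<le> 1" "\<bar>x\<bar> \<le> r"
    using assms by (auto simp: r_def x_def abs_Re_le_cmod)
  have sq: "(cmod (1 - w))\<^sup>2 = 1 - 2 * x + r\<^sup>2"
    unfolding r_def x_def cmod_power2 by (simp add: power2_eq_square algebra_simps)
  have pos: "(cmod (1 - w))\<^sup>2 > 0" using assms by simp
  have "Re (1 / (1 - w)) = (1 - x) / (1 - 2 * x + r\<^sup>2)"
    unfolding sq[symmetric] by (simp add: Re_divide x_def cmod_power2)
  moreover have "1 / (1 + r) \<le> (1 - x) / (1 - 2 * x + r\<^sup>2)"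
  proof -
    have "(r + x) * (1 - r) \<ge> 0" using r by auto
    then have "1 - 2 * x + r\<^sup>2 \<le> (1 - x) * (1 + r)"
      by (simp add: algebra_simps power2_eq_square)
    then show ?thesis
      using pos r by (simp add: sq divide_simps mult.commute)
  qed
  ultimately show ?thesis by (simp add: r_def)
qed

lemma Re_inverse_one_minus_unit:
  assumes "cmod w = 1" "w \<noteq> 1"
  shows "Re (1 / (1 - w)) = 1 / 2"
proof -
  have "(Re w)\<^sup>2 + (Im w)\<^sup>2 = 1" using assms by (simp flip: cmod_power2)
  moreover from this have "Re w \<noteq> 1" using assms by (auto simp: complex_eq_iff)
  ultimately show ?thesis
    by (simp add: Re_divide power2_eq_square divide_simps) (simp add: algebra_simps)
qed

lemma Re_one_minus_scaled_pos:
  assumes "cmod z = 1" "z \<noteq> 1" "0 \<le> s" "s \<le> 1"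
  shows "Re (1 - of_real s * z) > 0"
proof (cases "Re z \<le> 0")
  case True
  then have "s * Re z \<le> 0" using assms by (simp add: mult_nonneg_nonpos)
  then show ?thesis by simp
next
  case False
  have "Re z < 1"
  proof (rule ccontr)
    assume "\<not> Re z < 1"
    then have "Re z = 1" using complex_Re_le_cmod[of z] assms by simp
    moreover have "(Re z)\<^sup>2 + (Im z)\<^sup>2 = 1" using assms by (simp flip: cmod_power2)
    ultimately show False using assms by (auto simp: complex_eq_iff)
  qed
  moreover have "s * Re z \<le> 1 * Re z" using False assms by (intro mult_right_mono) auto
  ultimately show ?thesis by simp
qed

text \<open>Keeps the arguments of the principal logarithm off its branch cut along the whole
  segment, the endpoint \<open>s = 1\<close> included, so that the antiderivatives below are
  differentiable there.\<close>

lemma one_minus_scaled_regular: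
  assumes "cmod z = 1" "z \<noteq> 1" "0 \<le> s" "s \<le> 1"
  shows "1 - of_real s * z \<notin> \<real>\<^sub>\<le>\<^sub>0" "1 - of_real s * z \<noteq> 0"
proof -
  note pos = Re_one_minus_scaled_pos[OF assms]
  show "1 - of_real s * z \<notin> \<real>\<^sub>\<le>\<^sub>0" using pos by (auto simp: complex_nonpos_Reals_iff)
  show "1 - of_real s * z \<noteq> 0" using pos by (metis less_irrefl zero_complex.sel(1))
qed

lemma cis_neq_1:
  assumes "0 < \<theta>" "\<theta> < 2 * pi"
  shows "cis \<theta> \<noteq> 1"
proof
  assume "cis \<theta> = 1"
  then have "cos \<theta> = 1" by (metis cis.sel(1) one_complex.sel(1))
  then obtain n :: int where n: "\<theta> = of_int n * 2 * pi" by (auto simp: cos_one_2pi_int)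
  with assms have "0 < n" "n < 1" by (auto simp: zero_less_mult_iff)
  then show False by simp
qed

lemma has_real_derivative_Re_of_real:
  assumes "(f has_field_derivative f') (at (of_real x))"
  shows "((\<lambda>x. Re (f (of_real x))) has_real_derivative Re f') (at x)"
  using bounded_linear.has_vector_derivative[OF bounded_linear_Re has_vector_derivative_real_field[OF assms, of UNIV]]
  by (simp add: has_real_derivative_iff_has_vector_derivative)

text \<open>With \<open>q = 1 - c\<close> and \<open>z = cis \<theta>\<close> the left-hand side is the second derivative of the potential
  of \<open>min t c\<close>. The logarithmic term is the integral of \<open>Re (1 / (1 - s z)) \<ge> 1 / (1 + s)\<close> over
  \<open>[q, 1]\<close>, and \<open>3 / 4 - s / 4\<close> is the tangent to \<open>1 / (1 + s)\<close> at \<open>s = 1\<close>.\<close>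

lemma Ln_quotient_lower_bound:
  assumes z: "cmod z = 1" "z \<noteq> 1" and q: "0 \<le> q" "q < 1"
  shows "Re ((Ln (1 - of_real q * z) - Ln (1 - z)) / z) + Re (of_real q / (1 - of_real q * z))
      - Re (1 / (1 - z)) \<ge> (1 - q) / 8"
proof -
  \<comment> \<open>The antiderivative of \<open>Re (1 / (1 - s z))\<close> minus that of the
    tangent \<open>3 / 4 - s / 4\<close>. Its derivative is nonnegative because 1 / (1 + s) lies
    above its tangent.\<close>
  define v where "v s = Re (- (Ln (1 - of_real s * z) / z)) - (3 / 4 * s - s\<^sup>2 / 8)" for s
  have "v q \<le> v 1"
  proof (rule DERIV_nonneg_imp_nondecreasing[of q 1 v])
    show "q \<le> 1" using q by simp
    fix s assume s: "q \<le> s" "s \<le> 1"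
    note reg = one_minus_scaled_regular[OF z, of s]
    have z0: "z \<noteq> 0" using z by auto
    have "((\<lambda>s. - (Ln (1 - s * z) / z)) has_field_derivative 1 / (1 - of_real s * z)) (at (of_real s))"
      using reg s q z0 by (auto intro!: derivative_eq_intros simp: field_simps)
    from has_real_derivative_Re_of_real[OF this]
    have "(v has_real_derivative Re (1 / (1 - of_real s * z)) - (3 / 4 - s / 4)) (at s)"
      unfolding v_def by (rule DERIV_diff) (auto intro!: derivative_eq_intros)
    moreover have "Re (1 / (1 - of_real s * z)) - (3 / 4 - s / 4) \<ge> 0"
    proof -
      have "Re (1 / (1 - of_real s * z)) \<ge> 1 / (1 + s)"
        using Re_inverse_one_minus_ge[of "of_real s * z"] reg s q z by (simp add: norm_mult)
      moreover have "1 / (1 + s) - (3 / 4 - s / 4) = (1 - s)\<^sup>2 / (4 * (1 + s))"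
        using s q by (simp add: field_simps power2_eq_square)
      moreover have "\<dots> \<ge> 0" using s q by simp
      ultimately show ?thesis by linarith
    qed
    ultimately show "\<exists>y. (v has_real_derivative y) (at s) \<and> 0 \<le> y" by blast
  qed
  moreover have "Re ((Ln (1 - of_real q * z) - Ln (1 - z)) / z)
      = v 1 - v q + (5 / 8 - 3 / 4 * q + q\<^sup>2 / 8)"
    by (simp add: v_def diff_divide_distrib)
  moreover have "Re (of_real q / (1 - of_real q * z)) \<ge> q / (1 + q)"
  proof -
    have "of_real q * z \<noteq> 1" using one_minus_scaled_regular(2)[OF z, of q] q by auto
    then have "q * Re (1 / (1 - of_real q * z)) \<ge> q * (1 / (1 + q))"
      using Re_inverse_one_minus_ge[of "of_real q * z"] q z
      by (intro mult_left_mono) (auto simp: norm_mult)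
    moreover have "Re (of_real q / (1 - of_real q * z)) = q * Re (1 / (1 - of_real q * z))"
      using Re_of_real_mult[of q "1 / (1 - of_real q * z)"] by simp
    ultimately show ?thesis by simp
  qed
  moreover have "Re (1 / (1 - z)) = 1 / 2"
    using Re_inverse_one_minus_unit z by simp
  \<comment> \<open>The quadratic in \<open>v\<close> takes the value 3/4 - 1/8 = 5/8 at 1. Adding
    the separate lower bounds exceeds the claimed one by the nonnegative remainder on the
    right.\<close>
  moreover have "5 / 8 - 3 / 4 * q + q\<^sup>2 / 8 + q / (1 + q) - 1 / 2 - (1 - q) / 8
      = q * (1 - q) * (3 - q) / (8 * (1 + q))"
    using q by (simp add: field_simps power2_eq_square)
  moreover have "q * (1 - q) * (3 - q) / (8 * (1 + q)) \<ge> 0" using q by simp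
  ultimately show ?thesis by linarith
qed

lemma continuous_on_kern:
  assumes "cis \<theta> \<noteq> 1"
  shows "continuous_on {0..1} (\<lambda>t. kern t \<theta>)"
  unfolding kern_def
  using one_minus_scaled_regular(2)[of "cis \<theta>" "1 - t" for t] assms
  by (intro continuous_intros) auto

lemma potential_min:
  assumes c: "0 < c" "c \<le> 1" and \<theta>: "cis \<theta> \<noteq> 1"
  shows "potential (\<lambda>t. min t c) \<theta> = Re (of_real c + (1 / cis \<theta> - 1) * Ln (1 - cis \<theta>)
    - (1 / cis \<theta> - of_real (1 - c)) * Ln (1 - of_real (1 - c) * cis \<theta>))"
proof -
  define z where "z = cis \<theta>"
  have z: "cmod z = 1" "z \<noteq> 1" "z \<noteq> 0" using \<theta> by (auto simp: z_def)
  \<comment> \<open>Antiderivatives for the two pieces of the weight: \<open>F1\<close> for the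
    factor \<open>t\<close> on \<open>[0, c]\<close>, \<open>F2\<close> for the constant factor
    \<open>c\<close> on \<open>[c, 1]\<close>.\<close>
  define F1 where "F1 t = - (of_real (1 - t) + (1 / z - 1) * Ln (1 - of_real (1 - t) * z))" for t
  define F2 where "F2 t = of_real c * Ln (1 - of_real (1 - t) * z)" for t
  have 1: "((\<lambda>t. of_real t * (z / (1 - of_real (1 - t) * z))) has_integral (F1 c - F1 0)) {0..c}"
  proof (rule fundamental_theorem_of_calculus)
    fix t assume t: "t \<in> {0..c}"
    note reg = one_minus_scaled_regular[OF z(1,2), of "1 - t"]
    have "((\<lambda>t. - ((1 - t) + (1 / z - 1) * Ln (1 - (1 - t) * z))) has_field_derivative
        of_real t * (z / (1 - of_real (1 - t) * z))) (at (of_real t))"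
      using reg t c z(3)
      by (auto intro!: derivative_eq_intros simp: divide_simps) (auto simp: algebra_simps)
    from has_vector_derivative_real_field[OF this]
    show "(F1 has_vector_derivative of_real t * (z / (1 - of_real (1 - t) * z))) (at t within {0..c})"
      by (simp add: F1_def[abs_def])
  qed (use c in auto)
  have 2: "((\<lambda>t. of_real c * (z / (1 - of_real (1 - t) * z))) has_integral (F2 1 - F2 c)) {c..1}"
  proof (rule fundamental_theorem_of_calculus)
    fix t assume t: "t \<in> {c..1}"
    note reg = one_minus_scaled_regular[OF z(1,2), of "1 - t"]
    have "((\<lambda>t. of_real c * Ln (1 - (1 - t) * z)) has_field_derivative
        of_real c * (z / (1 - of_real (1 - t) * z))) (at (of_real t))"
      using reg t c
      by (auto intro!: derivative_eq_intros simp: divide_simps)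
    from has_vector_derivative_real_field[OF this]
    show "(F2 has_vector_derivative of_real c * (z / (1 - of_real (1 - t) * z))) (at t within {c..1})"
      by (simp add: F2_def[abs_def])
  qed (use c in auto)
  have int: "((\<lambda>t. of_real (min t c) * (z / (1 - of_real (1 - t) * z))) has_integral
      (F1 c - F1 0) + (F2 1 - F2 c)) {0..1}"
  proof (rule has_integral_combine)
    show "((\<lambda>t. of_real (min t c) * (z / (1 - of_real (1 - t) * z))) has_integral (F1 c - F1 0)) {0..c}"
      by (rule has_integral_eq[OF _ 1]) auto
    show "((\<lambda>t. of_real (min t c) * (z / (1 - of_real (1 - t) * z))) has_integral (F2 1 - F2 c)) {c..1}"
      by (rule has_integral_eq[OF _ 2]) auto
  qed (use c in auto)
  have val: "(F1 c - F1 0) + (F2 1 - F2 c) = of_real c + (1 / z - 1) * Ln (1 - z)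
      - (1 / z - of_real (1 - c)) * Ln (1 - of_real (1 - c) * z)"
    by (simp add: F1_def F2_def algebra_simps)
  have "Re (of_real (min t c) * (z / (1 - of_real (1 - t) * z))) = min t c * kern t \<theta>" for t
    by (simp only: kern_def z_def Re_of_real_mult)
  with has_integral_Re[OF int]
  have "((\<lambda>t. min t c * kern t \<theta>) has_integral Re (of_real c + (1 / z - 1) * Ln (1 - z)
      - (1 / z - of_real (1 - c)) * Ln (1 - of_real (1 - c) * z))) {0..1}"
    by (simp only: val)
  moreover have "set_integrable lborel {0..1} (\<lambda>t. min t c * kern t \<theta>)"
    by (intro borel_integrable_atLeastAtMost' continuous_intros continuous_on_kern[OF \<theta>])
  ultimately show ?thesis
    unfolding potential_def z_def[symmetric]
    by (simp add: set_borel_integral_eq_integral(2) integral_unique)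
qed

lemma convex_on_cong_on:
  assumes "convex_on S f" "\<And>x. x \<in> S \<Longrightarrow> f x = h x"
  shows "convex_on S h"
  using assms by (auto simp: convex_on_def convex_def)

text \<open>The second derivative of the potential is the expression bounded below in
  \<open>Ln_quotient_lower_bound\<close> by (1 - q) / 8 = c / 8, which is the second derivative of
  the subtracted quadratic.\<close>

lemma convex_on_potential_min:
  assumes c: "0 < c" "c \<le> 1"
  shows "convex_on {0<..<2*pi} (\<lambda>\<theta>. potential (\<lambda>t. min t c) \<theta> - c / 16 * \<theta>\<^sup>2)"
proof -
  define q where "q = 1 - c"
  have q: "0 \<le> q" "q < 1" using c by (auto simp: q_def)
  \<comment> \<open>The closed form of the potential before taking real parts, as a function of a
    complex angle \<open>w\<close>, so that complex differentiation applies; \<open>\<Phi>'\<close>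
    and \<open>\<Phi>''\<close> are its first two derivatives at the real angles in
    question.\<close>
  define \<Phi> where "\<Phi> w = of_real c + (exp (- \<i> * w) - 1) * Ln (1 - exp (\<i> * w))
    - (exp (- \<i> * w) - of_real q) * Ln (1 - of_real q * exp (\<i> * w))" for w
  define \<Phi>' where "\<Phi>' w = \<i> * (exp (- \<i> * w) * (Ln (1 - of_real q * exp (\<i> * w)) - Ln (1 - exp (\<i> * w)))
    - of_real c)" for w
  define \<Phi>'' where "\<Phi>'' w = exp (- \<i> * w) * (Ln (1 - of_real q * exp (\<i> * w)) - Ln (1 - exp (\<i> * w)))
    + of_real q / (1 - of_real q * exp (\<i> * w)) - 1 / (1 - exp (\<i> * w))" for w
  have ee: "exp (- \<i> * w) * exp (\<i> * w) = 1" for w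
    by (simp flip: exp_add)
  have reg: "1 - exp (\<i> * of_real \<theta>) \<notin> \<real>\<^sub>\<le>\<^sub>0" "1 - exp (\<i> * of_real \<theta>) \<noteq> 0"
      "1 - of_real q * exp (\<i> * of_real \<theta>) \<notin> \<real>\<^sub>\<le>\<^sub>0" "1 - of_real q * exp (\<i> * of_real \<theta>) \<noteq> 0"
    if "0 < \<theta>" "\<theta> < 2 * pi" for \<theta>
    using one_minus_scaled_regular[of "cis \<theta>" 1] one_minus_scaled_regular[of "cis \<theta>" q]
      cis_neq_1[OF that] q by (auto simp: cis_conv_exp)
  have "convex_on {0<..<2*pi} (\<lambda>\<theta>. Re (\<Phi> (of_real \<theta>)) - c / 16 * \<theta>\<^sup>2)"
  proof (rule f''_ge0_imp_convex)
    fix \<theta> assume "\<theta> \<in> {0<..<2*pi}"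
    then have \<theta>: "0 < \<theta>" "\<theta> < 2 * pi" by auto
    define z where "z = exp (\<i> * of_real \<theta>)"
    define y where "y = exp (- \<i> * of_real \<theta>)"
    note r = reg[OF \<theta>, folded z_def]
    have yz: "y * z = 1" unfolding y_def z_def by (rule ee)
    have "(\<Phi> has_field_derivative
        (- \<i> * y) * Ln (1 - z) + (y - 1) * (- (\<i> * z) / (1 - z))
        - ((- \<i> * y) * Ln (1 - of_real q * z) + (y - of_real q) * (- (of_real q * (\<i> * z)) / (1 - of_real q * z))))
        (at (of_real \<theta>))"
      unfolding \<Phi>_def using reg[OF \<theta>]
      by (auto intro!: derivative_eq_intros simp: y_def z_def divide_inverse mult_ac)
    \<comment> \<open>As \<open>y * z = 1\<close>, the coefficient of each logarithm cancels the
      denominator of its derivative: (y - 1) z = 1 - z and (y - q) z = 1 - q z. What remains is -i +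
      i q = -i c.\<close>
    moreover have "(- \<i> * y) * Ln (1 - z) + (y - 1) * (- (\<i> * z) / (1 - z))
        - ((- \<i> * y) * Ln (1 - of_real q * z) + (y - of_real q) * (- (of_real q * (\<i> * z)) / (1 - of_real q * z)))
        = \<Phi>' (of_real \<theta>)"
    proof -
      have "(y - 1) * (- (\<i> * z) / (1 - z)) = - \<i> * ((y * z - z) / (1 - z))"
        by (simp add: divide_inverse) (simp add: algebra_simps)
      also have "\<dots> = - \<i>" using r yz by simp
      finally have 1: "(y - 1) * (- (\<i> * z) / (1 - z)) = - \<i>" .
      have "(y - of_real q) * (- (of_real q * (\<i> * z)) / (1 - of_real q * z))
          = - \<i> * of_real q * ((y * z - of_real q * z) / (1 - of_real q * z))"
        by (simp add: divide_inverse) (simp add: algebra_simps)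
      also have "\<dots> = - \<i> * of_real q" using r yz by simp
      finally have 2: "(y - of_real q) * (- (of_real q * (\<i> * z)) / (1 - of_real q * z)) = - \<i> * of_real q" .
      show ?thesis unfolding 1 2 \<Phi>'_def y_def[symmetric] z_def[symmetric]
        by (simp add: q_def algebra_simps)
    qed
    ultimately have D1: "(\<Phi> has_field_derivative \<Phi>' (of_real \<theta>)) (at (of_real \<theta>))" by simp
    have "(\<Phi>' has_field_derivative
        \<i> * ((- \<i> * y) * (Ln (1 - of_real q * z) - Ln (1 - z))
          + y * (- (of_real q * (\<i> * z)) / (1 - of_real q * z) - (- (\<i> * z) / (1 - z))))) (at (of_real \<theta>))"
      unfolding \<Phi>'_def using reg[OF \<theta>]
      by (auto intro!: derivative_eq_intros simp: y_def z_def divide_inverse mult_ac)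
    moreover have "\<i> * ((- \<i> * y) * (Ln (1 - of_real q * z) - Ln (1 - z))
          + y * (- (of_real q * (\<i> * z)) / (1 - of_real q * z) - (- (\<i> * z) / (1 - z)))) = \<Phi>'' (of_real \<theta>)"
    proof -
      have "y * (- (of_real q * (\<i> * z)) / (1 - of_real q * z) - (- (\<i> * z) / (1 - z)))
        = - \<i> * ((y * z) * of_real q / (1 - of_real q * z) - (y * z) / (1 - z))"
        by (simp add: divide_inverse) (simp add: algebra_simps)
      also have "\<dots> = - \<i> * (of_real q / (1 - of_real q * z) - 1 / (1 - z))"
        by (simp only: yz mult_1)
      finally have eq: "y * (- (of_real q * (\<i> * z)) / (1 - of_real q * z) - (- (\<i> * z) / (1 - z)))
        = - \<i> * (of_real q / (1 - of_real q * z) - 1 / (1 - z))" .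
      show ?thesis unfolding eq \<Phi>''_def y_def[symmetric] z_def[symmetric]
        by (simp add: algebra_simps)
    qed
    ultimately have D2: "(\<Phi>' has_field_derivative \<Phi>'' (of_real \<theta>)) (at (of_real \<theta>))" by simp
    show "((\<lambda>\<theta>. Re (\<Phi> (of_real \<theta>)) - c / 16 * \<theta>\<^sup>2) has_real_derivative
        Re (\<Phi>' (of_real \<theta>)) - c / 8 * \<theta>) (at \<theta>)"
      by (rule DERIV_diff[OF has_real_derivative_Re_of_real[OF D1]]) (auto intro!: derivative_eq_intros)
    show "((\<lambda>\<theta>. Re (\<Phi>' (of_real \<theta>)) - c / 8 * \<theta>) has_real_derivative
        Re (\<Phi>'' (of_real \<theta>)) - c / 8) (at \<theta>)"
      by (rule DERIV_diff[OF has_real_derivative_Re_of_real[OF D2]]) (auto intro!: derivative_eq_intros)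
    have z1: "cmod z = 1" "z \<noteq> 1" "z \<noteq> 0" using r by (auto simp: z_def)
    have "y = 1 / z" using yz z1 by (simp add: field_simps)
    then show "Re (\<Phi>'' (of_real \<theta>)) - c / 8 \<ge> 0"
      using Ln_quotient_lower_bound[OF z1(1,2) q]
      unfolding \<Phi>''_def y_def[symmetric] z_def[symmetric] by (simp add: q_def)
  qed auto
  moreover have "Re (\<Phi> (of_real \<theta>)) = potential (\<lambda>t. min t c) \<theta>" if "\<theta> \<in> {0<..<2*pi}" for \<theta>
    using that potential_min[OF c cis_neq_1]
    by (simp add: \<Phi>_def q_def cis_conv_exp exp_minus divide_inverse)
  ultimately show ?thesis
    by (elim convex_on_cong_on) simp
qed

section \<open>Concave weights\<close>

lemma kern_measurable [measurable]: "(\<lambda>t. kern t \<theta>) \<in> borel_measurable borel"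
  unfolding kern_def by measurable

lemma one_minus_scaled_cis_norm:
  assumes "0 < t" "t \<le> 1"
  shows "cmod (1 - of_real (1 - t) * cis \<theta>) \<ge> t"
proof -
  have "cmod (of_real (1 - t) * cis \<theta>) = 1 - t"
    by (simp only: norm_mult norm_of_real norm_cis) (use assms in simp)
  then show ?thesis using norm_triangle_ineq2[of 1 "of_real (1 - t) * cis \<theta>"] by simp
qed

text \<open>Uniform in \<open>\<theta>\<close>, so \<open>g t / t\<close> dominates the integrand of
  the potential at every angle.\<close>

lemma abs_kern_le:
  assumes "0 < t" "t \<le> 1"
  shows "\<bar>kern t \<theta>\<bar> \<le> 1 / t"
proof -
  note * = one_minus_scaled_cis_norm[OF assms, of \<theta>]
  have "\<bar>kern t \<theta>\<bar> \<le> cmod (cis \<theta> / (1 - of_real (1 - t) * cis \<theta>))"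
    unfolding kern_def by (rule abs_Re_le_cmod)
  also have "\<dots> = 1 / cmod (1 - of_real (1 - t) * cis \<theta>)" by (simp add: norm_divide)
  also have "\<dots> \<le> 1 / t" using * assms by (intro frac_le) auto
  finally show ?thesis .
qed

lemma isCont_kern:
  assumes "0 < t" "t \<le> 1"
  shows "isCont (kern t) \<theta>"
proof -
  have "1 - of_real (1 - t) * cis \<theta> \<noteq> 0" for \<theta>
    using one_minus_scaled_cis_norm[OF assms, of \<theta>] assms by auto
  then have "continuous_on UNIV (kern t)"
    unfolding kern_def[abs_def] by (intro continuous_intros) auto
  then show ?thesis by (simp add: continuous_on_eq_continuous_at)
qed

section \<open>Passing to the limit in convexity\<close>

lemma convex_on_LIMSEQ:
  assumes "\<And>n. convex_on S (f n)" and lim: "\<And>x. x \<in> S \<Longrightarrow> (\<lambda>n. f n x) \<longlonglongrightarrow> (F x :: real)"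
  shows "convex_on S F"
proof (rule convex_onI)
  show S: "convex S" using assms(1) convex_on_imp_convex by blast
  fix t :: real and x y assume t: "0 < t" "t < 1" and xy: "x \<in> S" "y \<in> S"
  then have "(1 - t) *\<^sub>R x + t *\<^sub>R y \<in> S" using S by (intro convexD_alt) auto
  then have "(\<lambda>n. f n ((1 - t) *\<^sub>R x + t *\<^sub>R y)) \<longlonglongrightarrow> F ((1 - t) *\<^sub>R x + t *\<^sub>R y)" by (rule lim)
  moreover have "(\<lambda>n. (1 - t) * f n x + t * f n y) \<longlonglongrightarrow> (1 - t) * F x + t * F y"
    by (intro tendsto_intros lim xy)
  ultimately show "F ((1 - t) *\<^sub>R x + t *\<^sub>R y) \<le> (1 - t) * F x + t * F y"
    by (rule LIMSEQ_le) (use convex_onD[OF assms(1)] t xy in auto)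
qed

text \<open>Contracting slightly towards the midpoint moves the closed interval into the open one
  and commutes with convex combinations. Convexity holds for the contracted points, and continuity
  lets the contraction tend to the identity.\<close>

lemma convex_on_Icc_of_Ioo:
  fixes f :: "real \<Rightarrow> real"
  assumes conv: "convex_on {a<..<b} f" and cont: "continuous_on {a..b} f" and "a < b"
  shows "convex_on {a..b} f"
proof (rule convex_onI)
  fix t x y assume t: "0 < t" "t < (1::real)" and xy: "x \<in> {a..b}" "y \<in> {a..b}"
  \<comment> \<open>The shift by 2 makes \<open>s n < 1\<close> already at
    \<open>n = 0\<close>.\<close>
  define s where "s n = 1 / real (n + 2)" for n
  have s: "0 < s n" "s n < 1" for n by (auto simp: s_def)
  have s0: "s \<longlonglongrightarrow> 0" unfolding s_def by real_asymp
  define m where "m = (a + b) / 2"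
  define p where "p n x = (1 - s n) * x + s n * m" for n x
  have p_in: "p n x \<in> {a<..<b}" if "x \<in> {a..b}" for n x
  proof -
    have "(1 - s n) * x \<ge> (1 - s n) * a" "(1 - s n) * x \<le> (1 - s n) * b"
      using that s[of n] by (auto intro!: mult_left_mono)
    moreover have "s n * m > s n * a" "s n * m < s n * b"
      using s[of n] \<open>a < b\<close> by (auto simp: m_def)
    ultimately show ?thesis by (simp add: p_def algebra_simps)
  qed
  have p_lim: "(\<lambda>n. f (p n x)) \<longlonglongrightarrow> f x" if "x \<in> {a..b}" for x
  proof (rule continuous_on_tendsto_compose[OF cont _ that])
    have "(\<lambda>n. (1 - s n) * x + s n * m) \<longlonglongrightarrow> (1 - 0) * x + 0 * m"
      by (intro tendsto_intros s0)
    then show "(\<lambda>n. p n x) \<longlonglongrightarrow> x" by (simp add: p_def)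
    show "\<forall>\<^sub>F n in sequentially. p n x \<in> {a..b}"
      using p_in[OF that] by (auto intro!: always_eventually less_imp_le)
  qed
  have xy': "(1 - t) *\<^sub>R x + t *\<^sub>R y \<in> {a..b}"
    using xy t by (intro convexD_alt) auto
  have "p n ((1 - t) *\<^sub>R x + t *\<^sub>R y) = (1 - t) *\<^sub>R p n x + t *\<^sub>R p n y" for n
    by (simp add: p_def algebra_simps)
  then have le: "f (p n ((1 - t) *\<^sub>R x + t *\<^sub>R y)) \<le> (1 - t) * f (p n x) + t * f (p n y)" for n
    using convex_onD[OF conv, of t "p n x" "p n y"] t p_in xy by simp
  show "f ((1 - t) *\<^sub>R x + t *\<^sub>R y) \<le> (1 - t) * f x + t * f y"
    by (rule LIMSEQ_le[OF p_lim[OF xy'] tendsto_add[OF tendsto_mult[OF tendsto_const p_lim[OF xy(1)]]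
          tendsto_mult[OF tendsto_const p_lim[OF xy(2)]]]]) (use le in blast)
qed auto

text \<open>Used in \<open>interp_eq\<close> to pass from differences of slopes times truncated
  linear functions to slopes times increments.\<close>

lemma sum_by_parts:
  fixes s m :: "nat \<Rightarrow> 'a::comm_ring"
  shows "(\<Sum>j<n. (s j - s (Suc j)) * m (Suc j)) = (\<Sum>j<n. s j * (m (Suc j) - m j)) + s 0 * m 0 - s n * m n"
  by (induction n) (auto simp: algebra_simps)

section \<open>Integrability, continuity and convexity of the potential of a concave weight\<close>

locale concave_weight =
  fixes g :: "real \<Rightarrow> real"
  assumes concave: "concave_on {0..1} g"
    and mono: "mono_on {0..1} g"
    and zero: "g 0 = 0"
    and integral_finite: "(\<integral>\<^sup>+s\<in>{0..1}. ennreal (g s / s) \<partial>lborel) < \<infinity>"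
begin

lemma nonneg: "0 \<le> t \<Longrightarrow> t \<le> 1 \<Longrightarrow> 0 \<le> g t"
  using mono_onD[OF mono, of 0 t] zero by simp

lemma secant_le:
  assumes "0 \<le> x" "x \<le> y" "y \<le> 1" "0 \<le> u" "u \<le> 1"
  shows "(1 - u) * g x + u * g y \<le> g ((1 - u) * x + u * y)"
  using concave_onD[OF concave, of u x y] assms by simp

lemma ray_le:
  assumes "0 \<le> s" "s \<le> t" "t \<le> 1" "0 < t"
  shows "s / t * g t \<le> g s"
  using secant_le[of 0 t "s / t"] assms zero by simp

lemma measurable_on: "set_borel_measurable borel {0..1} g"
  using borel_measurable_mono_on_fnc[OF mono]
  by (simp add: set_borel_measurable_def borel_measurable_restrict_space_iff)

lemma set_integrable_quotient: "set_integrable lborel {0..1} (\<lambda>t. g t / t)"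
proof -
  have [measurable]: "(\<lambda>t. indicator {0..1} t *\<^sub>R g t) \<in> borel_measurable borel"
    using measurable_on by (simp add: set_borel_measurable_def)
  have eq: "(\<lambda>t. indicator {0..1} t *\<^sub>R (g t / t)) = (\<lambda>t. (indicator {0..1} t *\<^sub>R g t) / t)"
    by auto
  have "integrable lborel (\<lambda>t. (indicator {0..1} t *\<^sub>R g t) / t)"
  proof (rule integrableI_nonneg)
    show "AE t in lborel. 0 \<le> (indicator {0..1} t *\<^sub>R g t) / t"
      by (auto simp: indicator_def nonneg)
    have "(\<integral>\<^sup>+t. ennreal ((indicator {0..1} t *\<^sub>R g t) / t) \<partial>lborel)
        = (\<integral>\<^sup>+s\<in>{0..1}. ennreal (g s / s) \<partial>lborel)"
      by (intro nn_integral_cong) (auto simp: indicator_def)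
    then show "(\<integral>\<^sup>+t. ennreal ((indicator {0..1} t *\<^sub>R g t) / t) \<partial>lborel) < \<infinity>"
      using integral_finite by simp
  qed measurable
  then show ?thesis by (simp only: set_integrable_def eq)
qed

lemma dominated_by_quotient:
  assumes "\<And>t. t \<in> {0..1} \<Longrightarrow> \<bar>f t\<bar> \<le> g t" "t \<in> {0..1}"
  shows "\<bar>f t * kern t \<theta>\<bar> \<le> g t / t"
\<comment> \<open>At \<open>t = 0\<close> both sides vanish:
  \<open>\<bar>f 0\<bar> \<le> g 0 = 0\<close>, and division by zero yields 0.\<close>
proof (cases "t = 0")
  case True
  then show ?thesis using assms(1)[of 0] zero by simp
next
  case False
  then have "\<bar>f t\<bar> * \<bar>kern t \<theta>\<bar> \<le> g t * (1 / t)"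
    using assms abs_kern_le[of t \<theta>] by (intro mult_mono) (auto simp: nonneg)
  then show ?thesis by (simp add: abs_mult)
qed

lemma set_integrable_kern:
  assumes "set_borel_measurable borel {0..1} f" "\<And>t. t \<in> {0..1} \<Longrightarrow> \<bar>f t\<bar> \<le> g t"
  shows "set_integrable lborel {0..1} (\<lambda>t. f t * kern t \<theta>)"
proof (rule set_integrable_bound[OF set_integrable_quotient])
  have [measurable]: "(\<lambda>t. indicator {0..1} t *\<^sub>R f t) \<in> borel_measurable borel"
    using assms(1) by (simp add: set_borel_measurable_def)
  have eq: "(\<lambda>t. indicator {0..1} t *\<^sub>R (f t * kern t \<theta>)) = (\<lambda>t. (indicator {0..1} t *\<^sub>R f t) * kern t \<theta>)"
    by auto
  show "set_borel_measurable lborel {0..1} (\<lambda>t. f t * kern t \<theta>)"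
    unfolding set_borel_measurable_def eq by measurable
  show "AE t in lborel. t \<in> {0..1} \<longrightarrow> norm (f t * kern t \<theta>) \<le> norm (g t / t)"
    using dominated_by_quotient[OF assms(2)] nonneg by (intro AE_I2) fastforce
qed

text \<open>Dominated convergence with bound \<open>g t / t\<close>. Letting both weight and angle
  vary serves the continuity of the potential in the angle as well as the approximation of
  \<open>g\<close> at a fixed angle.\<close>

lemma potential_LIMSEQ:
  assumes f: "\<And>n. set_borel_measurable borel {0..1} (f n)" "\<And>n t. t \<in> {0..1} \<Longrightarrow> \<bar>f n t\<bar> \<le> g t"
    and lim: "\<And>t. 0 < t \<Longrightarrow> t \<le> 1 \<Longrightarrow> (\<lambda>n. f n t * kern t (x n)) \<longlonglongrightarrow> g t * kern t y"
  shows "(\<lambda>n. potential (f n) (x n)) \<longlonglongrightarrow> potential g y"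
  unfolding potential_def set_lebesgue_integral_def
proof (rule integral_dominated_convergence)
  show "(\<lambda>t. indicator {0..1} t *\<^sub>R (g t * kern t y)) \<in> borel_measurable lborel"
    using set_integrable_kern[OF measurable_on, of y] nonneg
    by (simp add: set_integrable_def borel_measurable_integrable)
  show "(\<lambda>t. indicator {0..1} t *\<^sub>R (f n t * kern t (x n))) \<in> borel_measurable lborel" for n
    using set_integrable_kern[OF f, of n "x n"]
    by (simp add: set_integrable_def borel_measurable_integrable)
  show "integrable lborel (\<lambda>t. indicator {0..1} t *\<^sub>R (g t / t))"
    using set_integrable_quotient by (simp add: set_integrable_def)
  have "norm (indicator {0..1} t *\<^sub>R (f n t * kern t (x n))) \<le> indicator {0..1} t *\<^sub>R (g t / t)" for n t
    using dominated_by_quotient[of "f n" t "x n"] f(2)[of _ n] by (cases "t \<in> {0..1}") simp_all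
  then show "AE t in lborel. norm (indicator {0..1} t *\<^sub>R (f n t * kern t (x n))) \<le> indicator {0..1} t *\<^sub>R (g t / t)" for n
    by (intro AE_I2)
  have "AE t in lborel. t \<noteq> (0::real)" by (rule AE_lborel_singleton)
  then show "AE t in lborel. (\<lambda>n. indicator {0..1} t *\<^sub>R (f n t * kern t (x n)))
      \<longlonglongrightarrow> indicator {0..1} t *\<^sub>R (g t * kern t y)"
    by eventually_elim (auto simp: indicator_def intro!: lim)
qed

lemma continuous_on_potential: "continuous_on UNIV (potential g)"
  unfolding continuous_on_sequentially o_def
proof (intro allI ballI impI)
  fix x :: "nat \<Rightarrow> real" and y assume "(\<forall>n. x n \<in> UNIV) \<and> x \<longlonglongrightarrow> y"
  then show "(\<lambda>n. potential g (x n)) \<longlonglongrightarrow> potential g y"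
    using isCont_tendsto_compose[OF isCont_kern]
    by (intro potential_LIMSEQ measurable_on) (auto intro!: tendsto_intros simp: nonneg)
qed

text \<open>The piecewise linear interpolation of \<open>g\<close> at the multiples of \<open>1 / n\<close>, written as a combination of
  the functions \<open>min t c\<close>; concavity makes the coefficients nonnegative. The convention
  \<open>slope n n = 0\<close> takes care of the last node.\<close>

definition slope :: "nat \<Rightarrow> nat \<Rightarrow> real"
  where "slope n j = (if j < n then n * (g (Suc j / n) - g (j / n)) else 0)"

definition interp :: "nat \<Rightarrow> real \<Rightarrow> real"
  where "interp n t = (\<Sum>j<n. (slope n j - slope n (Suc j)) * min t (Suc j / n))"

text \<open>At an inner node this is concavity at the middle of three consecutive nodes. At the last
  node \<open>slope n n = 0\<close>, and the claim is that the last increment of \<open>g\<close> is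
  nonnegative, which is monotonicity.\<close>

lemma slope_decreasing:
  assumes "j < n"
  shows "slope n (Suc j) \<le> slope n j"
proof (cases "Suc j < n")
  case True
  have "(1 - 1/2) * g (j / n) + 1/2 * g (Suc (Suc j) / n) \<le> g ((1 - 1/2) * (j / n) + 1/2 * (Suc (Suc j) / n))"
    using True by (intro secant_le) (auto simp: divide_simps)
  also have "(1 - 1/2) * (j / n) + 1/2 * (Suc (Suc j) / n) = Suc j / n"
    using True by (simp add: field_simps)
  finally have "real n * (g (Suc (Suc j) / n) - g (Suc j / n)) \<le> real n * (g (Suc j / n) - g (j / n))"
    by (intro mult_left_mono) auto
  then show ?thesis using True by (simp add: slope_def)
next
  case False
  then have "Suc j = n" using assms by simp
  then show ?thesis
    using mono_onD[OF mono, of "j / n" "Suc j / n"] by (auto simp: slope_def divide_simps)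
qed

text \<open>After summation by parts each slope is multiplied by the length of the part of its cell
  to the left of \<open>t\<close>: \<open>1 / n\<close> for cells before the \<open>k\<close>-th,
  \<open>t - k / n\<close> for the \<open>k\<close>-th, and 0 beyond. The sum over the full cells
  telescopes.\<close>

lemma interp_eq:
  assumes k: "k < n" and t: "k / n \<le> t" "t \<le> Suc k / n"
  shows "interp n t = g (k / n) + slope n k * (t - k / n)"
proof -
  have t0: "0 \<le> t" using t(1) by (meson divide_nonneg_nonneg of_nat_0_le_iff order_trans)
  have "interp n t = (\<Sum>j<n. slope n j * (min t (Suc j / n) - min t (j / n)))"
    using sum_by_parts[of "slope n" "\<lambda>j. min t (j / n)" n] t0
    by (simp add: interp_def slope_def)
  also have "\<dots> = (\<Sum>j<Suc k. slope n j * (min t (Suc j / n) - min t (j / n)))"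
  proof (rule sum.mono_neutral_right)
    show "\<forall>j\<in>{..<n} - {..<Suc k}. slope n j * (min t (Suc j / n) - min t (j / n)) = 0"
    proof
      fix j assume "j \<in> {..<n} - {..<Suc k}"
      then have "Suc k / n \<le> j / n" "j / n \<le> Suc j / n"
        by (intro divide_right_mono; simp)+
      then show "slope n j * (min t (Suc j / n) - min t (j / n)) = 0" using t by simp
    qed
  qed (use k in auto)
  also have "\<dots> = (\<Sum>j<k. g (Suc j / n) - g (j / n)) + slope n k * (t - k / n)"
  proof -
    have "slope n j * (min t (Suc j / n) - min t (j / n)) = g (Suc j / n) - g (j / n)" if "j < k" for j
    proof -
      have "Suc j / n \<le> k / n" "j / n \<le> Suc j / n"
        using that by (intro divide_right_mono; simp)+
      then have "min t (Suc j / n) - min t (j / n) = 1 / n" using t by (simp add: diff_divide_distrib[symmetric])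
      then show ?thesis using that k by (simp add: slope_def)
    qed
    moreover have "min t (Suc k / n) - min t (k / n) = t - k / n" using t by simp
    ultimately show ?thesis by simp
  qed
  also have "(\<Sum>j<k. g (Suc j / n) - g (j / n)) = g (k / n)"
    using sum_lessThan_telescope[of "\<lambda>j. g (j / n)" k] zero by simp
  finally show ?thesis .
qed

lemma interp_1: "n > 0 \<Longrightarrow> interp n 1 = g 1"
  using interp_eq[of "n - 1" n 1] by (simp add: slope_def divide_simps)

text \<open>The upper bound is concavity on the cell containing \<open>t\<close>. For the lower
  bound, \<open>interp n t\<close> is at least \<open>g (k / n)\<close>, and \<open>ray_le\<close>
  compares this with \<open>g t\<close>, using \<open>k / n \<ge> t - 1 / n\<close>.\<close>

lemma interp_bounds:
  assumes n: "n > 0" and t: "0 \<le> t" "t \<le> 1"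
  shows "0 \<le> interp n t" "interp n t \<le> g t" "t > 0 \<Longrightarrow> (1 - 1 / (n * t)) * g t \<le> interp n t"
proof -
  \<comment> \<open>At \<open>t = 1\<close> the floor of \<open>n * t\<close> would be
    \<open>n\<close>, which is not the index of a cell, so the last cell is chosen by hand.\<close>
  obtain k where k: "k < n" "k / n \<le> t" "t \<le> Suc k / n"
  proof (cases "t = 1")
    case True
    with n show ?thesis by (intro that[of "n - 1"]) (auto simp: divide_simps)
  next
    case False
    define k where "k = nat \<lfloor>n * t\<rfloor>"
    have 1: "real k \<le> n * t" "n * t < real k + 1"
      using t by (auto simp: k_def)
    have "real n * t < real n * 1" using False t n by (intro mult_strict_left_mono) auto
    then have "real k < n" using 1 by linarith
    with 1 n show ?thesis by (intro that[of k]) (auto simp: field_simps)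
  qed
  note eq = interp_eq[OF k]
  have g_le: "g (k / n) \<le> g (Suc k / n)"
    using k by (intro mono_onD[OF mono]) (auto simp: divide_simps)
  then have ge: "g (k / n) \<le> interp n t"
    using k unfolding eq by (simp add: slope_def)
  moreover have "0 \<le> g (k / n)" using k by (intro nonneg) (auto simp: divide_simps)
  ultimately show "0 \<le> interp n t" by simp
  have "interp n t = (1 - (n * t - k)) * g (k / n) + (n * t - k) * g (Suc k / n)"
    using k n unfolding eq by (simp add: slope_def field_simps)
  also have "\<dots> \<le> g ((1 - (n * t - k)) * (k / n) + (n * t - k) * (Suc k / n))"
    using k n by (intro secant_le) (auto simp: field_simps)
  also have "(1 - (n * t - k)) * (k / n) + (n * t - k) * (Suc k / n) = t"
    using n by (simp add: field_simps)
  finally show "interp n t \<le> g t" .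
  show "(1 - 1 / (n * t)) * g t \<le> interp n t" if "t > 0"
  proof -
    have "t - 1 / n \<le> k / n" using k(3) by (simp add: add_divide_distrib)
    then have "(t - 1 / n) / t \<le> k / n / t" using that by (intro divide_right_mono) auto
    then have "1 - 1 / (n * t) \<le> k / n / t" using that n by (simp add: field_simps)
    then have "(1 - 1 / (n * t)) * g t \<le> k / n / t * g t"
      using nonneg[OF t] by (intro mult_right_mono)
    also have "\<dots> \<le> g (k / n)" using k t that by (intro ray_le) auto
    finally show ?thesis using ge by simp
  qed
qed

lemma interp_LIMSEQ:
  assumes "0 < t" "t \<le> 1"
  shows "(\<lambda>n. interp n t) \<longlonglongrightarrow> g t"
proof (rule tendsto_sandwich)
  show "\<forall>\<^sub>F n in sequentially. (1 - 1 / (n * t)) * g t \<le> interp n t"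
    using eventually_gt_at_top[of 0] by eventually_elim (use assms interp_bounds in auto)
  show "\<forall>\<^sub>F n in sequentially. interp n t \<le> g t"
    using eventually_gt_at_top[of 0] by eventually_elim (use assms interp_bounds in auto)
  have "(\<lambda>n. (1 - 1 / (real n * t))) \<longlonglongrightarrow> 1" using assms by real_asymp
  from tendsto_mult_right[OF this, of "g t"]
  show "(\<lambda>n. (1 - 1 / (real n * t)) * g t) \<longlonglongrightarrow> g t" by simp
qed simp

lemma continuous_on_interp: "continuous_on S (interp n)"
  unfolding interp_def[abs_def] by (intro continuous_intros)

lemma potential_interp_LIMSEQ: "(\<lambda>n. potential (interp n) \<theta>) \<longlonglongrightarrow> potential g \<theta>"
proof (rule potential_LIMSEQ)
  show "set_borel_measurable borel {0..1} (interp n)" for n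
    unfolding set_borel_measurable_def
    by (intro borel_measurable_continuous_on_indicator continuous_on_interp) auto
  show "\<bar>interp n t\<bar> \<le> g t" if "t \<in> {0..1}" for n t
    using that interp_bounds[of n t] nonneg by (cases "n = 0") (auto simp: interp_def)
qed (intro tendsto_intros interp_LIMSEQ)

text \<open>For \<open>cis \<theta> \<noteq> 1\<close> the kernel is continuous on
  \<open>[0, 1]\<close>, so every truncated weight is integrable against it on its own and the
  integral splits.\<close>

lemma potential_interp:
  assumes "cis \<theta> \<noteq> 1"
  shows "potential (interp n) \<theta>
    = (\<Sum>j<n. (slope n j - slope n (Suc j)) * potential (\<lambda>t. min t (Suc j / n)) \<theta>)"
proof -
  have "set_integrable lborel {0..1} (\<lambda>t. min t c * kern t \<theta>)" for c
    by (intro borel_integrable_atLeastAtMost' continuous_intros continuous_on_kern assms)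
  then have int: "integrable lborel (\<lambda>t. indicator {0..1} t *\<^sub>R (min t c * kern t \<theta>))" for c
    by (simp add: set_integrable_def)
  have "potential (interp n) \<theta> = (\<integral>t. (\<Sum>j<n. (slope n j - slope n (Suc j)) *
      (indicator {0..1} t *\<^sub>R (min t (Suc j / n) * kern t \<theta>))) \<partial>lborel)"
    unfolding potential_def set_lebesgue_integral_def interp_def
    by (intro Bochner_Integration.integral_cong refl) (simp add: sum_distrib_left sum_distrib_right mult_ac)
  also have "\<dots> = (\<Sum>j<n. (slope n j - slope n (Suc j)) * potential (\<lambda>t. min t (Suc j / n)) \<theta>)"
    unfolding potential_def set_lebesgue_integral_def
    by (subst Bochner_Integration.integral_sum, intro integrable_mult_right int, simp)
  finally show ?thesis .
qed

lemma convex_on_potential_interp: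
  assumes "n > 0"
  shows "convex_on {0<..<2*pi} (\<lambda>\<theta>. potential (interp n) \<theta> - g 1 / 16 * \<theta>\<^sup>2)"
proof -
  have conv: "convex_on {0<..<2*pi} (\<lambda>\<theta>. \<Sum>j<m. (slope n j - slope n (Suc j)) *
      (potential (\<lambda>t. min t (Suc j / n)) \<theta> - (Suc j / n) / 16 * \<theta>\<^sup>2))" if "m \<le> n" for m
    using that
  proof (induction m)
    case (Suc m)
    show ?case
      unfolding sum.lessThan_Suc
    proof (rule convex_on_add)
      show "convex_on {0<..<2*pi} (\<lambda>\<theta>. \<Sum>j<m. (slope n j - slope n (Suc j)) *
          (potential (\<lambda>t. min t (Suc j / n)) \<theta> - (Suc j / n) / 16 * \<theta>\<^sup>2))"
        using Suc by simp
      show "convex_on {0<..<2*pi} (\<lambda>\<theta>. (slope n m - slope n (Suc m)) *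
          (potential (\<lambda>t. min t (Suc m / n)) \<theta> - (Suc m / n) / 16 * \<theta>\<^sup>2))"
        by (intro convex_on_cmul convex_on_potential_min)
           (use slope_decreasing[of m n] Suc.prems assms in \<open>auto simp: divide_simps\<close>)
    qed
  qed (simp add: convex_on_const)
  \<comment> \<open>At \<open>t = 1\<close> every \<open>min t (Suc j / n)\<close> equals
    \<open>Suc j / n\<close>, so the quadratic corrections of the pieces add up to one with constant
    \<open>interp n 1 = g 1\<close>, independent of \<open>n\<close>.\<close>
  have "g 1 = (\<Sum>j<n. (slope n j - slope n (Suc j)) * (Suc j / n))"
    unfolding interp_1[OF assms, symmetric] interp_def
    using assms by (intro sum.cong refl arg_cong2[where f = "(*)"] min_absorb2) (auto simp: divide_simps)
  then have g1: "g 1 / 16 * \<theta>\<^sup>2 = (\<Sum>j<n. (slope n j - slope n (Suc j)) * ((Suc j / n) / 16 * \<theta>\<^sup>2))" for \<theta>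
    by (simp add: sum_divide_distrib sum_distrib_right mult.assoc)
  show ?thesis
    by (rule convex_on_cong_on[OF conv[OF order_refl]])
       (simp only: potential_interp[OF cis_neq_1] greaterThanLessThan_iff right_diff_distrib
         sum_subtractf g1)
qed

text \<open>The closed interval matters: coinciding points produce gaps equal to 0 or
  \<open>2 * pi\<close>, and so do the pairs of a point with itself.\<close>

lemma convex_on_potential: "convex_on {0..2*pi} (\<lambda>\<theta>. potential g \<theta> - g 1 / 16 * \<theta>\<^sup>2)"
proof (rule convex_on_Icc_of_Ioo)
  show "convex_on {0<..<2*pi} (\<lambda>\<theta>. potential g \<theta> - g 1 / 16 * \<theta>\<^sup>2)"
  proof (rule convex_on_LIMSEQ)
    show "convex_on {0<..<2*pi} (\<lambda>\<theta>. potential (interp (Suc n)) \<theta> - g 1 / 16 * \<theta>\<^sup>2)" for n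
      by (rule convex_on_potential_interp) simp
    show "(\<lambda>n. potential (interp (Suc n)) \<theta> - g 1 / 16 * \<theta>\<^sup>2) \<longlonglongrightarrow> potential g \<theta> - g 1 / 16 * \<theta>\<^sup>2" for \<theta>
      using potential_interp_LIMSEQ by (intro tendsto_intros) (rule LIMSEQ_Suc)
  qed
  show "continuous_on {0..2*pi} (\<lambda>\<theta>. potential g \<theta> - g 1 / 16 * \<theta>\<^sup>2)"
    using continuous_on_potential by (auto intro!: continuous_intros intro: continuous_on_subset)
qed simp

end

section \<open>Energy of points on the circle\<close>

lemma potential_periodic: "potential g (\<theta> + 2 * pi) = potential g \<theta>"
  by (simp add: potential_def kern_def cis.ctr)

lemma bij_betw_add_mod:
  fixes i N :: nat
  assumes "i < N"
  shows "bij_betw (\<lambda>l. (i + l) mod N) {..<N} {..<N}"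
proof (rule bij_betwI[where g = "\<lambda>k. (k + (N - i)) mod N"])
  show "((i + l) mod N + (N - i)) mod N = l" if "l \<in> {..<N}" for l
  proof -
    have "((i + l) mod N + (N - i)) mod N = (i + l + (N - i)) mod N" by (simp add: mod_add_left_eq)
    also have "i + l + (N - i) = l + N" using assms by simp
    finally show ?thesis using that by simp
  qed
  show "(i + (k + (N - i)) mod N) mod N = k" if "k \<in> {..<N}" for k
  proof -
    have "(i + (k + (N - i)) mod N) mod N = (i + (k + (N - i))) mod N" by (simp add: mod_add_right_eq)
    also have "i + (k + (N - i)) = k + N" using assms by simp
    finally show ?thesis using that by simp
  qed
qed (use assms in auto)

text \<open>The pairs of points are grouped by the number \<open>l\<close> of steps that separate them along the
  circle.\<close>

definition gap :: "nat \<Rightarrow> (nat \<Rightarrow> real) \<Rightarrow> nat \<Rightarrow> nat \<Rightarrow> real"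
  where "gap N \<theta> i l = \<theta> ((i + l) mod N) - \<theta> i + (if i + l < N then 0 else 2 * pi)"

lemma energy_by_gaps:
  assumes per: "\<And>x. K (x + 2 * pi) = K x"
  shows "(\<Sum>j<N. \<Sum>k<N. K (\<theta> k - \<theta> j)) = (\<Sum>l<N. \<Sum>i<N. (K (gap N \<theta> i l) :: real))"
proof -
  have "(\<Sum>k<N. K (\<theta> k - \<theta> i)) = (\<Sum>l<N. K (gap N \<theta> i l))" if "i < N" for i
  proof -
    have "(\<Sum>k<N. K (\<theta> k - \<theta> i)) = (\<Sum>l<N. K (\<theta> ((i + l) mod N) - \<theta> i))"
      by (rule sum.reindex_bij_betw[OF bij_betw_add_mod[OF that], symmetric])
    also have "\<dots> = (\<Sum>l<N. K (gap N \<theta> i l))"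
      by (intro sum.cong refl) (simp add: gap_def per)
    finally show ?thesis .
  qed
  then have "(\<Sum>j<N. \<Sum>k<N. K (\<theta> k - \<theta> j)) = (\<Sum>i<N. \<Sum>l<N. K (gap N \<theta> i l))"
    by (rule sum.cong[OF refl]) simp
  also have "\<dots> = (\<Sum>l<N. \<Sum>i<N. K (gap N \<theta> i l))" by (rule sum.swap)
  finally show ?thesis .
qed

text \<open>The angles cancel because the shift permutes the indices; exactly \<open>l\<close>
  indices wrap around, each contributing \<open>2 * pi\<close>. The average gap thus does not depend
  on the points.\<close>

lemma sum_gap:
  assumes "l < N"
  shows "(\<Sum>i<N. gap N \<theta> i l) = 2 * pi * l"
proof -
  have "(\<Sum>i<N. \<theta> ((i + l) mod N)) = (\<Sum>i<N. \<theta> i)"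
    using sum.reindex_bij_betw[OF bij_betw_add_mod[OF assms], of \<theta>] by (simp add: add.commute)
  moreover have "(\<Sum>i<N. if i + l < N then 0 else 2 * pi) = 2 * pi * l"
  proof -
    have "{..<N} \<inter> {i. \<not> i + l < N} = {N - l..<N}" using assms by auto
    then show ?thesis
      using assms by (simp add: sum.If_cases Collect_neg_eq[symmetric])
  qed
  ultimately show ?thesis by (simp add: gap_def sum.distrib sum_subtractf)
qed

text \<open>Without wrapping, sortedness gives the lower bound. With wrapping, the index moves
  backwards, so the difference of angles lies between \<open>-2 * pi\<close> and 0 before
  \<open>2 * pi\<close> is added.\<close>

lemma gap_bounds:
  assumes "\<And>i j. i \<le> j \<Longrightarrow> j < N \<Longrightarrow> \<theta> i \<le> \<theta> j" "\<And>i. i < N \<Longrightarrow> 0 \<le> \<theta> i \<and> \<theta> i \<le> 2 * pi"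
    and "i < N" "l < N"
  shows "gap N \<theta> i l \<in> {0..2*pi}"
proof (cases "i + l < N")
  case True
  then show ?thesis
    using assms(1)[of i "i + l"] assms(2)[of i] assms(2)[of "i + l"] by (simp add: gap_def)
next
  case False
  then have "(i + l) mod N = i + l - N" using assms by (simp add: mod_if)
  moreover have "i + l - N \<le> i" "i + l - N < N" using assms(3,4) by auto
  ultimately show ?thesis
    using False assms(1)[of "i + l - N" i] assms(2)[of i] assms(2)[of "i + l - N"] assms(3)
    by (auto simp: gap_def)
qed

lemma gap_equispaced:
  assumes "i < N" "l < N"
  shows "gap N (\<lambda>k. 2 * pi * k / N) i l = 2 * pi * l / N"
proof (cases "i + l < N")
  case True
  then show ?thesis by (simp add: gap_def add_divide_distrib distrib_left)
next
  case False
  then have "(i + l) mod N = i + l - N" using assms by (simp add: mod_if)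
  then show ?thesis using False assms by (simp add: gap_def of_nat_diff divide_simps) (simp add: algebra_simps)
qed

text \<open>Jensen's inequality for \<open>K x - \<beta> * x\<^sup>2\<close>, followed by the
  identity that expresses the variance of the \<open>d i\<close> as mean square minus squared
  mean.\<close>

lemma strongly_convex_Jensen:
  fixes K :: "real \<Rightarrow> real"
  assumes conv: "convex_on S (\<lambda>x. K x - \<beta> * x\<^sup>2)" and N: "N > 0"
    and d: "\<And>i. i < N \<Longrightarrow> d i \<in> S" and m: "(\<Sum>i<N. d i) = real N * m"
  shows "(\<Sum>i<N. K (d i)) \<ge> N * K m + \<beta> * (\<Sum>i<N. (d i - m)\<^sup>2)"
proof -
  have m': "(\<Sum>i<N. (1 / real N) *\<^sub>R d i) = m"
    using N by (simp add: m flip: sum_divide_distrib)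
  have "(\<lambda>x. K x - \<beta> * x\<^sup>2) (\<Sum>i<N. (1 / real N) *\<^sub>R d i) \<le> (\<Sum>i<N. (1 / real N) * (K (d i) - \<beta> * (d i)\<^sup>2))"
    by (rule convex_on_sum[OF _ _ conv]) (use N d in \<open>auto simp: lessThan_empty_iff\<close>)
  then have "K m - \<beta> * m\<^sup>2 \<le> (\<Sum>i<N. (1 / real N) * (K (d i) - \<beta> * (d i)\<^sup>2))"
    by (simp only: m')
  also have "\<dots> = (\<Sum>i<N. K (d i) - \<beta> * (d i)\<^sup>2) / N"
    by (simp add: sum_divide_distrib)
  finally have "N * (K m - \<beta> * m\<^sup>2) \<le> (\<Sum>i<N. K (d i) - \<beta> * (d i)\<^sup>2)"
    using N by (simp add: field_simps)
  moreover have "(\<Sum>i<N. (d i - m)\<^sup>2) = (\<Sum>i<N. (d i)\<^sup>2) - N * m\<^sup>2"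
  proof -
    have "(\<Sum>i<N. (d i - m)\<^sup>2) = (\<Sum>i<N. (d i)\<^sup>2 + m\<^sup>2 - 2 * m * d i)"
      by (intro sum.cong refl) (simp add: power2_diff)
    also have "\<dots> = (\<Sum>i<N. (d i)\<^sup>2) + N * m\<^sup>2 - 2 * m * (\<Sum>i<N. d i)"
      by (simp add: sum_subtractf sum.distrib sum_distrib_left)
    finally show ?thesis by (simp add: m power2_eq_square)
  qed
  ultimately show ?thesis
    by (simp add: sum_subtractf right_diff_distrib mult.left_commute flip: sum_distrib_left)
qed

lemma energy_minimal_equispaced:
  fixes K :: "real \<Rightarrow> real" and N :: nat
  assumes per: "\<And>x. K (x + 2 * pi) = K x"
    and conv: "convex_on {0..2*pi} (\<lambda>x. K x - \<beta> * x\<^sup>2)" and \<beta>: "\<beta> > 0" and N: "N > 0"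
    and \<theta>: "\<And>i j. i \<le> j \<Longrightarrow> j < N \<Longrightarrow> \<theta> i \<le> \<theta> j" "\<And>i. i < N \<Longrightarrow> 0 \<le> \<theta> i \<and> \<theta> i \<le> 2 * pi"
  defines "E \<equiv> \<lambda>\<theta>. \<Sum>j<N. \<Sum>k<N. K (\<theta> k - \<theta> j)" and "eq \<equiv> \<lambda>k::nat. 2 * pi * k / N"
  shows "E eq \<le> E \<theta>" and "E eq = E \<theta> \<Longrightarrow> k < N \<Longrightarrow> \<theta> k = \<theta> 0 + eq k"
proof -
  \<comment> \<open>The total deviation of all gaps from their averages. Summing Jensen's inequality
    over \<open>l\<close> gives \<open>E eq + \<beta> * D \<le> E \<theta>\<close>, so equality of
    energies forces \<open>D = 0\<close>.\<close>
  define D where "D = (\<Sum>l<N. \<Sum>i<N. (gap N \<theta> i l - eq l)\<^sup>2)"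
  have "E eq = (\<Sum>l<N. \<Sum>i<N. K (eq l))"
    unfolding E_def energy_by_gaps[of K, OF per] eq_def
    by (intro sum.cong refl) (simp add: gap_equispaced)
  then have "E eq + \<beta> * D = (\<Sum>l<N. N * K (eq l) + \<beta> * (\<Sum>i<N. (gap N \<theta> i l - eq l)\<^sup>2))"
    by (simp add: D_def sum_distrib_left sum.distrib)
  also have "\<dots> \<le> (\<Sum>l<N. \<Sum>i<N. K (gap N \<theta> i l))"
  proof (intro sum_mono strongly_convex_Jensen[OF conv N])
    fix l assume "l \<in> {..<N}"
    then show "(\<Sum>i<N. gap N \<theta> i l) = real N * eq l"
      using N by (simp add: sum_gap eq_def)
  qed (use gap_bounds[OF \<theta>] in auto)
  also have "\<dots> = E \<theta>" unfolding E_def energy_by_gaps[of K, OF per] ..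
  finally have le: "E eq + \<beta> * D \<le> E \<theta>" .
  have "D \<ge> 0" unfolding D_def by (intro sum_nonneg) auto
  with le \<beta> show "E eq \<le> E \<theta>" by (smt (verit) mult_nonneg_nonneg)
  show "\<theta> k = \<theta> 0 + eq k" if "E eq = E \<theta>" "k < N"
  proof -
    have "\<beta> * D \<le> 0" using le that by simp
    with \<open>D \<ge> 0\<close> \<beta> have "D = 0" by (simp add: mult_le_0_iff)
    then have "(\<Sum>i<N. (gap N \<theta> i k - eq k)\<^sup>2) = 0"
      using that unfolding D_def by (subst (asm) sum_nonneg_eq_0_iff) (auto intro: sum_nonneg)
    \<comment> \<open>The gaps that start at point 0 already determine every angle, and they do not
      wrap since \<open>0 + k < N\<close>.\<close>
    then have "gap N \<theta> 0 k = eq k"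
      using N by (subst (asm) sum_nonneg_eq_0_iff) auto
    then show ?thesis using that by (simp add: gap_def)
  qed
qed

section \<open>The weighted norm as an energy\<close>

context concave_weight
begin

text \<open>\<open>g 1 / 16\<close> is the constant of strong convexity, so positivity here is what
  makes the minimiser unique.\<close>

lemma at_1_pos:
  assumes "\<exists>t\<in>{0..1}. g t \<noteq> 0"
  shows "g 1 > 0"
proof -
  obtain t where t: "t \<in> {0..1}" "g t \<noteq> 0" using assms by auto
  then have "0 < g t" using nonneg[of t] by auto
  also have "g t \<le> g 1" using t by (intro mono_onD[OF mono]) auto
  finally show ?thesis .
qed

text \<open>Concavity and \<open>g 0 = 0\<close> put \<open>g\<close> above the line
  \<open>t * g 1\<close>, whose integral is \<open>g 1 / 2\<close>. Integrability of
  \<open>g\<close> follows from \<open>g t \<le> g t / t\<close> for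
  \<open>0 < t \<le> 1\<close>.\<close>

lemma kappa_pos:
  assumes "g 1 > 0"
  shows "kappa g > 0"
proof -
  have int: "set_integrable lborel {0..1} g"
  proof (rule set_integrable_bound[OF set_integrable_quotient])
    show "set_borel_measurable lborel {0..1} g"
      using measurable_on by (simp add: set_borel_measurable_def)
    have "norm (g t) \<le> norm (g t / t)" if "t \<in> {0..1}" for t
      using that nonneg[of t] zero by (cases "t = 0") (auto simp: divide_simps mult_left_le)
    then show "AE t in lborel. t \<in> {0..1} \<longrightarrow> norm (g t) \<le> norm (g t / t)" by simp
  qed
  have "((\<lambda>t. t * g 1) has_integral (1 / 2) * g 1) {0..1}"
    using ident_has_integral[of 0 "1::real"] by (intro has_integral_mult_left) simp
  moreover have int1: "set_integrable lborel {0..1} (\<lambda>t. t * g 1)"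
    by (intro borel_integrable_atLeastAtMost' continuous_intros)
  ultimately have "(LBINT t:{0..1}. t * g 1) = g 1 / 2"
    by (simp add: set_borel_integral_eq_integral(2)[OF int1] integral_unique
      del: set_integral_mult_left set_integral_mult_right)
  moreover have "(LBINT t:{0..1}. t * g 1) \<le> (LBINT t:{0..1}. g t)"
    using ray_le[of _ 1] int int1 by (intro set_integral_mono) auto
  ultimately have "0 < (LBINT t:{0..1}. g t)" using assms by linarith
  then show ?thesis by (simp add: kappa_def)
qed

lemma wnorm_simple_fraction:
  fixes N :: nat
  assumes "kappa g > 0"
  defines "E \<equiv> \<lambda>\<theta>. \<Sum>j<N. \<Sum>k<N. potential g (\<theta> k - \<theta> j)"
  shows "wnorm g (\<lambda>z. \<Sum>k<N. 1 / (z - cis (\<theta> k))) = ennreal (sqrt (kappa g * E \<theta>))" and "E \<theta> \<ge> 0"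
proof -
  \<comment> \<open>Nothing is known about \<open>g\<close> outside \<open>[0, 1]\<close>; extended
    by 0 it is nonnegative and Borel on the whole line.\<close>
  define G where "G t = indicator {0..1} t *\<^sub>R g t" for t
  define a where "a k = cis (\<theta> k)" for k
  define S where "S t = (\<Sum>j<N. \<Sum>k<N. Re (cnj (a j) * a k / (1 - complex_of_real (1 - t) * (cnj (a j) * a k))))" for t
  have [measurable]: "G \<in> borel_measurable borel"
    using measurable_on by (simp add: set_borel_measurable_def G_def[abs_def])
  have G: "G t \<ge> 0" for t
    by (simp add: G_def indicator_def nonneg)
  have a: "cmod (a k) = 1" for k by (simp add: a_def)
  have S: "S t = (\<Sum>j<N. \<Sum>k<N. kern t (\<theta> k - \<theta> j))" for t
    by (simp add: S_def a_def kern_def cis_cnj cis_mult)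
  note disc = nn_integral_disc_simple_fraction[of N a G, OF a _ G, folded S_def]
  have int: "integrable lborel (\<lambda>t. indicator {0..1} t *\<^sub>R (g t * kern t \<phi>))" for \<phi>
    using set_integrable_kern[OF measurable_on, of \<phi>] nonneg by (simp add: set_integrable_def)
  have eq: "G t * S t = (\<Sum>j<N. \<Sum>k<N. indicator {0..1} t *\<^sub>R (g t * kern t (\<theta> k - \<theta> j)))" for t
    by (simp add: S G_def sum_distrib_left mult.assoc)
  have intGS: "integrable lborel (\<lambda>t. G t * S t)"
    unfolding eq by (intro Bochner_Integration.integrable_sum int)
  have intE: "(\<integral>t. G t * S t \<partial>lborel) = E \<theta>"
    unfolding eq E_def potential_def set_lebesgue_integral_def
    by (subst Bochner_Integration.integral_sum; intro Bochner_Integration.integrable_sum int sum.cong refl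
        Bochner_Integration.integral_sum)
  have GS: "G t * S t \<ge> 0" for t
  proof (cases "0 < t \<and> t \<le> 1")
    case True
    then show ?thesis using disc(2)[of t] G by simp
  next
    case False
    \<comment> \<open>The nonnegativity of \<open>S t\<close> is available only for
      \<open>0 < t \<le> 1\<close>. At \<open>t = 0\<close> the factor \<open>g 0 = 0\<close>
      settles the sign, elsewhere the indicator does.\<close>
    then have "G t = 0" using zero by (auto simp: G_def indicator_def)
    then show ?thesis by simp
  qed
  show E: "E \<theta> \<ge> 0" using GS unfolding intE[symmetric] by (intro integral_nonneg_AE) auto
  have "(\<integral>\<^sup>+z\<in>\<bbbD>. ennreal ((cmod (\<Sum>k<N. 1 / (z - a k)))\<^sup>2 * g (1 - (cmod z)\<^sup>2)) \<partial>m\<^sub>2)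
      = (\<integral>\<^sup>+z\<in>\<bbbD>. ennreal ((cmod (\<Sum>k<N. 1 / (z - a k)))\<^sup>2 * G (1 - (cmod z)\<^sup>2)) \<partial>m\<^sub>2)"
    by (intro nn_integral_cong) (auto simp: unit_disc_def G_def indicator_def abs_square_le_1)
  also have "\<dots> = (\<integral>\<^sup>+t\<in>{0..1}. ennreal (G t * S t) \<partial>lborel)"
    by (rule disc(1)) measurable
  also have "\<dots> = (\<integral>\<^sup>+t. ennreal (G t * S t) \<partial>lborel)"
    by (intro nn_integral_cong) (auto simp: G_def indicator_def)
  also have "\<dots> = ennreal (E \<theta>)"
    using nn_integral_eq_integral[OF intGS] GS by (simp add: intE)
  finally have "wnorm_sq g (\<lambda>z. \<Sum>k<N. 1 / (z - a k)) = ennreal (kappa g * E \<theta>)"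
    using assms E by (simp add: wnorm_sq_def ennreal_mult)
  then show "wnorm g (\<lambda>z. \<Sum>k<N. 1 / (z - cis (\<theta> k))) = ennreal (sqrt (kappa g * E \<theta>))"
    using assms E by (simp add: wnorm_def a_def)
qed

end

lemma root_of_unity_eq_cis: "root_of_unity N k = cis (2 * pi * k / N)"
  by (simp add: root_of_unity_def cis_conv_exp mult_ac)

text \<open>Sorted angles are what the bounds on the gaps require. The sorting permutation is kept
  because it becomes the reordering in \<open>equispaced\<close>.\<close>

lemma obtain_sorted_arguments:
  fixes a :: "nat \<Rightarrow> complex"
  assumes a: "\<And>k. k < N \<Longrightarrow> cmod (a k) = 1"
  obtains p \<theta> where "p permutes {..<N}" "\<And>k. k < N \<Longrightarrow> a (p k) = cis (\<theta> k)"
    "\<And>i j. i \<le> j \<Longrightarrow> j < N \<Longrightarrow> \<theta> i \<le> \<theta> j" "\<And>i. i < N \<Longrightarrow> 0 \<le> \<theta> i \<and> \<theta> i \<le> 2 * pi"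
proof -
  define xs where "xs = map (\<lambda>k. Arg2pi (a k)) [0..<N]"
  obtain p where p: "p permutes {..<length xs}" "permute_list p xs = sort xs"
    using mset_eq_permutation[of "sort xs" xs] by auto
  have len: "length xs = N" by (simp add: xs_def)
  have pN: "p k < N" if "k < N" for k
    using permutes_in_image[OF p(1), of k] that by (simp add: len)
  have nth: "sort xs ! k = Arg2pi (a (p k))" if "k < N" for k
    using that pN[OF that] by (simp add: p(2)[symmetric] permute_list_nth[OF p(1)] len) (simp add: xs_def)
  show ?thesis
  proof (rule that[of p "\<lambda>k. sort xs ! k"])
    show "p permutes {..<N}" using p(1) by (simp add: len)
    show "a (p k) = cis (sort xs ! k)" if "k < N" for k
      using Arg2pi_eq[of "a (p k)"] a[OF pN[OF that]] by (simp add: nth[OF that] cis_conv_exp)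
    show "sort xs ! i \<le> sort xs ! j" if "i \<le> j" "j < N" for i j
      using that by (intro sorted_nth_mono) (auto simp: len)
    show "0 \<le> sort xs ! i \<and> sort xs ! i \<le> 2 * pi" if "i < N" for i
      using Arg2pi_ge_0[of "a (p i)"] Arg2pi_lt_2pi[of "a (p i)"] by (simp add: nth[OF that])
  qed
qed

theorem theorem1:
  fixes g :: "real \<Rightarrow> real" and N :: nat and a :: "nat \<Rightarrow> complex"
  assumes g_nonzero: "\<exists>t\<in>{0..1}. g t \<noteq> 0"
    and g_concave: "concave_on {0..1} g"
    and g_mono: "mono_on {0..1} g"
    and g_0: "g 0 = 0"
    and g_int: "(\<integral>\<^sup>+s\<in>{0..1}. ennreal (g s / s) \<partial>lborel) < \<infinity>"
    and N: "N \<ge> 1"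
    and a: "\<forall>k<N. a k \<in> \<bbbT>"
  shows "wnorm g (\<lambda>z. \<Sum>k<N. 1 / (z - a k)) \<ge> wnorm g (Psi N) \<and>
    (wnorm g (\<lambda>z. \<Sum>k<N. 1 / (z - a k)) = wnorm g (Psi N) \<longrightarrow> equispaced N a)"
proof -
  interpret concave_weight g
    using g_concave g_mono g_0 g_int by unfold_locales
  have g1: "g 1 > 0" by (rule at_1_pos[OF g_nonzero])
  note \<kappa> = kappa_pos[OF g1]
  have na: "cmod (a k) = 1" if "k < N" for k using a that by (simp add: unit_circle_def)
  obtain p \<theta> where p: "p permutes {..<N}" and a_eq: "\<And>k. k < N \<Longrightarrow> a (p k) = cis (\<theta> k)"
    and \<theta>: "\<And>i j. i \<le> j \<Longrightarrow> j < N \<Longrightarrow> \<theta> i \<le> \<theta> j" "\<And>i. i < N \<Longrightarrow> 0 \<le> \<theta> i \<and> \<theta> i \<le> 2 * pi"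
    by (rule obtain_sorted_arguments[of N a]; use na in blast)
  define E where "E \<theta> = (\<Sum>j<N. \<Sum>k<N. potential g (\<theta> k - \<theta> j))" for \<theta> :: "nat \<Rightarrow> real"
  define eq where "eq k = 2 * pi * real k / real N" for k
  have "(\<Sum>k<N. 1 / (z - a k)) = (\<Sum>k<N. 1 / (z - cis (\<theta> k)))" for z
    by (subst sum.permute[OF p]) (simp add: a_eq)
  then have norm_a: "wnorm g (\<lambda>z. \<Sum>k<N. 1 / (z - a k)) = ennreal (sqrt (kappa g * E \<theta>))"
    using wnorm_simple_fraction(1)[OF \<kappa>, where N = N and \<theta> = \<theta>] by (simp add: E_def)
  have norm_Psi: "wnorm g (Psi N) = ennreal (sqrt (kappa g * E eq))"
    using wnorm_simple_fraction(1)[OF \<kappa>, where N = N and \<theta> = eq]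
    by (simp add: E_def eq_def Psi_def[abs_def] root_of_unity_eq_cis)
  have E_nonneg: "E \<phi> \<ge> 0" for \<phi>
    using wnorm_simple_fraction(2)[OF \<kappa>, where N = N and \<theta> = \<phi>] by (simp add: E_def)
  \<comment> \<open>The constant \<open>g 1 / 16\<close> comes from
    \<open>convex_on_potential\<close>.\<close>
  note min = energy_minimal_equispaced[of "potential g" "g 1 / 16" N \<theta>,
      OF potential_periodic convex_on_potential _ _ \<theta>, folded E_def eq_def]
  have "E eq \<le> E \<theta>" using min(1) g1 N by simp
  then have "wnorm g (Psi N) \<le> wnorm g (\<lambda>z. \<Sum>k<N. 1 / (z - a k))"
    unfolding norm_a norm_Psi using \<kappa> by (intro ennreal_leI real_sqrt_le_mono mult_left_mono) simp_all
  moreover have "equispaced N a" if "wnorm g (\<lambda>z. \<Sum>k<N. 1 / (z - a k)) = wnorm g (Psi N)"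
  proof -
    have "E eq = E \<theta>"
    proof -
      \<comment> \<open>\<open>ennreal\<close> identifies all negative reals with 0, so
        nonnegativity is needed to recover the energies from the norms.\<close>
      have "0 \<le> kappa g * E \<phi>" for \<phi> using \<kappa> E_nonneg[of \<phi>] by simp
      then have "kappa g * E \<theta> = kappa g * E eq"
        using that unfolding norm_a norm_Psi by (simp only: ennreal_inj real_sqrt_ge_zero real_sqrt_eq_iff)
      then show ?thesis using \<kappa> by simp
    qed
    then have arg: "\<theta> k = \<theta> 0 + eq k" if "k < N" for k
      using min(2)[of k] g1 N that by simp
    \<comment> \<open>The rotation in \<open>equispaced\<close> is the point with the smallest
      argument.\<close>
    have "a (p k) = cis (\<theta> 0) * root_of_unity N k" if "k < N" for k
      by (simp only: a_eq[OF that] arg[OF that] root_of_unity_eq_cis eq_def cis_mult)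
    then show ?thesis
      unfolding equispaced_def using p by (intro bexI[of _ "cis (\<theta> 0)"] exI[of _ p] conjI allI impI) (simp_all add: unit_circle_def)
  qed
  ultimately show ?thesis by blast
qed

end
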